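(* Let $\mathbb{G}$ be a stratified group (homogeneous Carnot group) with Jacobian generators $X_1,\ldots,X_N$, and let $\mathbb{G}^+=\{x\in\mathbb{G}:\langle x,\nu\rangle>d\}$ be a half-space of $\mathbb{G}$. Then for all $\beta\in\mathbb{R}$, all $p>1$ and all $u\in C_0^\infty(\mathbb{G}^+)$, $$\int_{\mathbb{G}^+}|\nabla_{\mathbb{G}}u|^p\,dx\;\geq\;-(p-1)\left(|\beta|^{\frac{p}{p-1}}+\beta\right)\int_{\mathbb{G}^+}\frac{\mathcal{W}(x)^p}{dist(x,\partial\mathbb{G}^+)^p}|u|^p\,dx+\beta\int_{\mathbb{G}^+}\frac{\mathcal{L}_p(dist(x,\partial\mathbb{G}^+))}{dist(x,\partial\mathbb{G}^+)^{p-1}}|u|^p\,dx.$$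
   Context: A stratified group (homogeneous Carnot group) is $\mathbb{G}=(\mathbb{R}^n,\circ,\delta_\lambda)$, where $\mathbb{R}^n=\mathbb{R}^{N_1}\times\cdots\times\mathbb{R}^{N_r}$ with $N_1=N$, points are written $x=(x',x^{(2)},\ldots,x^{(r)})$ with $x'\in\mathbb{R}^{N}$, $x^{(l)}\in\mathbb{R}^{N_l}$, $\circ$ is a Lie group law on $\mathbb{R}^n$, the dilations $\delta_\lambda(x)=(\lambda x',\lambda^2x^{(2)},\ldots,\lambda^rx^{(r)})$ are group automorphisms for all $\lambda>0$, and the left-invariant vector fields $X_1,\ldots,X_N$ (the Jacobian generators) with $X_k(0)=\partial/\partial x'_k|_0$ generate the whole Lie algebra of $\mathbb{G}$ (their iterated commutators span $\mathbb{R}^n$ at every point). They have the explicit form $$X_k=\frac{\partial}{\partial x'_k}+\sum_{l=2}^r\sum_{m=1}^{N_l}a^{(l)}_{k,m}(x',x^{(2)},\ldots,x^{(l-1)})\frac{\partial}{\partial x^{(l)}_m}$$ with polynomial coefficients $a_{k,m}^{(l)}$. Lebesgue measure $dx$ on $\mathbb{R}^n$ is the Haar measure of $\mathbb{G}$. The horizontal gradient is $\nabla_{\mathbb{G}}=(X_1,\ldots,X_N)$, the horizontal divergence of $v=(v_1,\ldots,v_N)$ is $\mathrm{div}_{\mathbb{G}}v=\sum_{k=1}^N X_kv_k$, and the $p$-sub-Laplacian is $\mathcal{L}_pv=\mathrm{div}_{\mathbb{G}}(|\nabla_{\mathbb{G}}v|^{p-2}\nabla_{\mathbb{G}}v)$,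 where $|\cdot|$ is the Euclidean norm. A half-space is $\mathbb{G}^+=\{x\in\mathbb{G}:\langle x,\nu\rangle>d\}$, where $d\in\mathbb{R}$, $\nu=(\nu_1,\ldots,\nu_r)$ with $\nu_j\in\mathbb{R}^{N_j}$ is the unit normal to the boundary $\partial\mathbb{G}^+$ (a unit vector of $\mathbb{R}^n$), and $\langle\cdot,\cdot\rangle$ is the Euclidean inner product on $\mathbb{R}^n$. The distance to the boundary is $dist(x,\partial\mathbb{G}^+)=\langle x,\nu\rangle-d$. Writing $X_i(x)\in\mathbb{R}^n$ for the coefficient vector of $X_i$ at $x$, the angle function is $\mathcal{W}(x)=\left(\sum_{i=1}^N\langle X_i(x),\nu\rangle^2\right)^{1/2}$. *)

theory Defs
  imports "HOL-Analysis.Analysis"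
begin

primrec times_differentiable_on :: "nat \<Rightarrow> 'a::real_normed_vector set \<Rightarrow> ('a \<Rightarrow> 'b::real_normed_vector) \<Rightarrow> bool" where
  "times_differentiable_on 0 S f \<longleftrightarrow> continuous_on S f"
| "times_differentiable_on (Suc n) S f \<longleftrightarrow>
     (\<forall>x\<in>S. f differentiable at x) \<and>
     (\<forall>v. times_differentiable_on n S (\<lambda>x. frechet_derivative f (at x) v))"

text \<open>Used for open \<open>S\<close> only.\<close>

definition smooth_on :: "'a::real_normed_vector set \<Rightarrow> ('a \<Rightarrow> 'b::real_normed_vector) \<Rightarrow> bool" where
  "smooth_on S f \<longleftrightarrow> (\<forall>n. times_differentiable_on n S f)"

definition lie_group_law :: "('a::real_normed_vector \<Rightarrow> 'a \<Rightarrow> 'a) \<Rightarrow> bool" where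
  "lie_group_law mul \<longleftrightarrow>
     (\<exists>e inv. group mul e inv \<and> smooth_on UNIV (\<lambda>(x, y). mul x y) \<and> smooth_on UNIV inv)"

text \<open>
  The decomposition of the coordinate space into $r$ layers is encoded by a map \<open>\<sigma>\<close> sending a
  coordinate index to its layer, so that $N_l$ is the number of indices \<open>j\<close> with \<open>\<sigma> j = l\<close>.
\<close>

definition dilation :: "('n::finite \<Rightarrow> nat) \<Rightarrow> real \<Rightarrow> real^'n \<Rightarrow> real^'n" where
  "dilation \<sigma> t x = (\<chi> j. t ^ \<sigma> j * x $ j)"

definition first_layer :: "('n::finite \<Rightarrow> nat) \<Rightarrow> 'n set" where
  "first_layer \<sigma> = {k. \<sigma> k = 1}"

text \<open>A vector field on the coordinate space is the function giving its coefficient vector at each point.\<close>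

definition left_invariant :: "(real^'n \<Rightarrow> real^'n \<Rightarrow> real^'n) \<Rightarrow> (real^'n \<Rightarrow> real^'n) \<Rightarrow> bool" where
  "left_invariant mul Y \<longleftrightarrow> (\<forall>a x. Y (mul a x) = frechet_derivative (mul a) (at x) (Y x))"

definition deriv_along :: "(real^'n \<Rightarrow> real^'n) \<Rightarrow> (real^'n \<Rightarrow> 'b::real_normed_vector) \<Rightarrow> real^'n \<Rightarrow> 'b" where
  "deriv_along Y f x = frechet_derivative f (at x) (Y x)"

definition commutator :: "(real^'n \<Rightarrow> real^'n) \<Rightarrow> (real^'n \<Rightarrow> real^'n) \<Rightarrow> real^'n \<Rightarrow> real^'n" where
  "commutator Y Z x = deriv_along Y Z x - deriv_along Z Y x"

inductive_set iterated_commutators :: "(real^'n \<Rightarrow> real^'n) set \<Rightarrow> (real^'n \<Rightarrow> real^'n) set"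
  for G :: "(real^'n \<Rightarrow> real^'n) set" where
  generator: "Y \<in> G \<Longrightarrow> Y \<in> iterated_commutators G"
| bracket: "Y \<in> iterated_commutators G \<Longrightarrow> Z \<in> iterated_commutators G \<Longrightarrow>
    commutator Y Z \<in> iterated_commutators G"

text \<open>
  The family \<open>X\<close> of Jacobian generators is indexed by all coordinates, but only its members \<open>X k\<close> with
  \<open>k\<close> in the first layer are constrained or used. The neutral element is forced to be \<open>0\<close>, the
  only common fixed point of the dilations.
\<close>

definition stratified_group ::
    "nat \<Rightarrow> ('n::finite \<Rightarrow> nat) \<Rightarrow> (real^'n \<Rightarrow> real^'n \<Rightarrow> real^'n) \<Rightarrow> ('n \<Rightarrow> real^'n \<Rightarrow> real^'n) \<Rightarrow> bool" where
  "stratified_group r \<sigma> mul X \<longleftrightarrow>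
     range \<sigma> = {1..r} \<and>
     lie_group_law mul \<and>
     (\<forall>t>0. \<forall>x y. dilation \<sigma> t (mul x y) = mul (dilation \<sigma> t x) (dilation \<sigma> t y)) \<and>
     (\<forall>k\<in>first_layer \<sigma>. left_invariant mul (X k) \<and> X k 0 = axis k 1) \<and>
     (\<forall>x. span ((\<lambda>Y. Y x) ` iterated_commutators (X ` first_layer \<sigma>)) = UNIV)"

text \<open>
  Horizontal vectors, i.e. elements of $\mathbb{R}^{N}$ with $N = N_1$, are represented as vectors of
  the full coordinate space whose components outside the first layer vanish; \<open>norm\<close> then is the
  Euclidean norm of $\mathbb{R}^{N}$.
\<close>

definition horizontal_grad ::
    "('n::finite \<Rightarrow> nat) \<Rightarrow> ('n \<Rightarrow> real^'n \<Rightarrow> real^'n) \<Rightarrow> (real^'n \<Rightarrow> real) \<Rightarrow> real^'n \<Rightarrow> real^'n" where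
  "horizontal_grad \<sigma> X f x = (\<chi> k. if k \<in> first_layer \<sigma> then deriv_along (X k) f x else 0)"

definition horizontal_div ::
    "('n::finite \<Rightarrow> nat) \<Rightarrow> ('n \<Rightarrow> real^'n \<Rightarrow> real^'n) \<Rightarrow> (real^'n \<Rightarrow> real^'n) \<Rightarrow> real^'n \<Rightarrow> real" where
  "horizontal_div \<sigma> X v x = (\<Sum>k\<in>first_layer \<sigma>. deriv_along (X k) (\<lambda>y. v y $ k) x)"

text \<open>
  Since \<open>0 powr a = 0\<close>, the field inside the divergence is \<open>0\<close> wherever the horizontal gradient
  vanishes. For \<open>p < 2\<close> it need not be differentiable there; the value of \<open>p_sub_laplacian\<close> at such a
  point is then unspecified.
\<close>

definition p_sub_laplacian ::
    "('n::finite \<Rightarrow> nat) \<Rightarrow> ('n \<Rightarrow> real^'n \<Rightarrow> real^'n) \<Rightarrow> real \<Rightarrow> (real^'n \<Rightarrow> real) \<Rightarrow> real^'n \<Rightarrow> real" where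
  "p_sub_laplacian \<sigma> X p v =
     horizontal_div \<sigma> X (\<lambda>y. norm (horizontal_grad \<sigma> X v y) powr (p - 2) *\<^sub>R horizontal_grad \<sigma> X v y)"

definition half_space :: "real^'n \<Rightarrow> real \<Rightarrow> (real^'n) set" where
  "half_space \<nu> d = {x. x \<bullet> \<nu> > d}"

definition boundary_dist :: "real^'n \<Rightarrow> real \<Rightarrow> real^'n \<Rightarrow> real" where
  "boundary_dist \<nu> d x = x \<bullet> \<nu> - d"

definition angle_function ::
    "('n::finite \<Rightarrow> nat) \<Rightarrow> ('n \<Rightarrow> real^'n \<Rightarrow> real^'n) \<Rightarrow> real^'n \<Rightarrow> real^'n \<Rightarrow> real" where
  "angle_function \<sigma> X \<nu> x = sqrt (\<Sum>i\<in>first_layer \<sigma>. (X i x \<bullet> \<nu>)\<^sup>2)"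

text \<open>$C_0^\infty(\Omega)$, each function being identified with its extension by zero to the whole space.\<close>

definition test_functions :: "'a::real_normed_vector set \<Rightarrow> ('a \<Rightarrow> real) set" where
  "test_functions \<Omega> =
     {u. smooth_on UNIV u \<and> compact (closure {x. u x \<noteq> 0}) \<and> closure {x. u x \<noteq> 0} \<subseteq> \<Omega>}"

end

theory Submission
  imports Defs
begin

text \<open>
  Put $w_k = \langle X_k, \nu\rangle$, $\delta = dist(\cdot, \partial\mathbb{G}^+)$ and
  $\varphi = |u|^p / \delta^{p-1}$. As $\nabla_{\mathbb{G}}\delta = w$ and the $X_k$ are divergence-free,
  $\int \mathcal{L}_p\delta\,\varphi = - \int |w|^{p-2} \langle w, \nabla_{\mathbb{G}}\varphi\rangle$; expanding
  $\nabla_{\mathbb{G}}\varphi$ and applying Young's inequality pointwise gives the claim.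

  The delicate point is this integration by parts for $p < 2$, where $|w|^{p-2} w$ is not differentiable
  on the set $w = 0$. By homogeneity under the dilations, the coefficients of the $X_k$ are polynomial
  along lines, hence so are the $w_k$. Therefore the zero set is null, and $|w_j|^{p-2} |\partial_m w_j|$
  is locally integrable: on a line it is, up to a factor, the modulus of the derivative of
  $|w_j|^{p-1}$, whose number of monotone pieces is bounded by the degree. It dominates the
  divergences of the regularized fields $(|w|^2 + \varepsilon)^{(p-2)/2} w$.
\<close>

subsection \<open>Powers of the modulus and polynomials\<close>

text \<open>Only restrictions to lines enter, never an expansion in several variables: the
  restriction decides how often a function vanishes and how often its derivative changes sign, and a
  degree bound common to all lines makes the one-dimensional estimate uniform. For p < 2 the weight
  |w|^(p-2) is unbounded and the divergence mixes all components of w. Since |w| >= |w_j| and the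
  exponent is negative, each derivative of w_j can be paired with |w_j|^(p-2) for the same j, which
  leaves a question about one scalar function. The limit of the regularization needs |w| > 0 almost
  everywhere, hence a case distinction on whether all w_k vanish identically. Integrability of the
  term with the p-sub-Laplacian has to be proved as well: otherwise its integral would be the
  default value 0 and the identity would say nothing about the field. In the constant, (p-1)
  |\<beta>|^(p/(p-1)) is the conjugate term of Young's inequality, while (p-1) \<beta> comes from
  differentiating \<delta>^(1-p).\<close>

definition signed_powr :: "real \<Rightarrow> real \<Rightarrow> real" where
  "signed_powr a s = max s 0 powr a - max (- s) 0 powr a"

lemma continuous_on_signed_powr: "a > 0 \<Longrightarrow> continuous_on S (signed_powr a)"
  unfolding signed_powr_def[abs_def] by (intro continuous_intros continuous_on_powr') auto

lemma abs_signed_powr: "\<bar>signed_powr a s\<bar> = \<bar>s\<bar> powr a"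
  by (cases "s \<ge> 0") (auto simp: signed_powr_def max_def)

text \<open>Makes \<open>signed_powr q\<close> divided by \<open>q\<close> the antiderivative of
  |s|^(q-1). The origin is excluded because for q < 1 the derivative blows up there; only continuity
  survives.\<close>

lemma has_real_derivative_signed_powr:
  assumes "s \<noteq> 0"
  shows "(signed_powr q has_real_derivative q * \<bar>s\<bar> powr (q - 1)) (at s)"
proof (cases "s > 0")
  case True
  have "((\<lambda>s. s powr q) has_real_derivative q * \<bar>s\<bar> powr (q - 1)) (at s)"
    using True by (auto intro!: derivative_eq_intros)
  moreover have "\<forall>\<^sub>F x in nhds s. x powr q = signed_powr q x"
    using eventually_nhds_in_open[of "{0<..}" s] True
    by (auto elim!: eventually_mono simp: signed_powr_def)
  ultimately show ?thesis
    using DERIV_cong_ev[of s s "\<lambda>s. s powr q" "signed_powr q"] by auto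
next
  case False
  then have s: "s < 0" using assms by auto
  have "((\<lambda>s. - ((- s) powr q)) has_real_derivative q * \<bar>s\<bar> powr (q - 1)) (at s)"
    using s by (auto intro!: derivative_eq_intros)
  moreover have "\<forall>\<^sub>F x in nhds s. - ((- x) powr q) = signed_powr q x"
    using eventually_nhds_in_open[of "{..<0}" s] s
    by (auto elim!: eventually_mono simp: signed_powr_def)
  ultimately show ?thesis
    using DERIV_cong_ev[of s s "\<lambda>s. - ((- s) powr q)" "signed_powr q"] by auto
qed

lemma has_real_derivative_abs_powr:
  fixes p :: real
  assumes p: "p > 1"
  shows "((\<lambda>s. \<bar>s\<bar> powr p) has_real_derivative p * signed_powr (p - 1) s) (at s)"
proof (cases s "0 :: real" rule: linorder_cases)
  case greater
  have "((\<lambda>s. s powr p) has_real_derivative p * signed_powr (p - 1) s) (at s)"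
    using greater by (auto intro!: derivative_eq_intros simp: signed_powr_def)
  moreover have "\<forall>\<^sub>F x in nhds s. x powr p = \<bar>x\<bar> powr p"
    using eventually_nhds_in_open[of "{0<..}" s] greater by (auto elim!: eventually_mono)
  ultimately show ?thesis
    using DERIV_cong_ev[of s s "\<lambda>s. s powr p" "\<lambda>s. \<bar>s\<bar> powr p"] by auto
next
  case less
  have "((\<lambda>s. (- s) powr p) has_real_derivative p * signed_powr (p - 1) s) (at s)"
    using less by (auto intro!: derivative_eq_intros simp: signed_powr_def)
  moreover have "\<forall>\<^sub>F x in nhds s. (- x) powr p = \<bar>x\<bar> powr p"
    using eventually_nhds_in_open[of "{..<0}" s] less by (auto elim!: eventually_mono)
  ultimately show ?thesis
    using DERIV_cong_ev[of s s "\<lambda>s. (- s) powr p" "\<lambda>s. \<bar>s\<bar> powr p"] by auto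
next
  \<comment> \<open>At the origin the difference quotient has modulus |h|^(p-1), which tends to 0
    because p > 1.\<close>
  case equal
  have "((\<lambda>h. \<bar>h\<bar> powr (p - 1)) \<longlongrightarrow> \<bar>0\<bar> powr (p - 1)) (at (0::real))"
  proof -
    have "continuous_on UNIV (\<lambda>h::real. \<bar>h\<bar> powr (p - 1))"
      using p by (intro continuous_intros continuous_on_powr') auto
    then show ?thesis unfolding continuous_on_def by blast
  qed
  moreover have "norm (\<bar>h\<bar> powr p / h) = \<bar>h\<bar> powr (p - 1)" if "h \<noteq> 0" for h :: real
    using that by (simp add: powr_diff abs_mult)
  then have "\<forall>\<^sub>F h in at 0. norm (\<bar>h\<bar> powr p / h) = \<bar>h\<bar> powr (p - 1)"
    by (auto simp: eventually_at_filter)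
  ultimately have "((\<lambda>h. norm (\<bar>h\<bar> powr p / h)) \<longlongrightarrow> 0) (at 0)"
    by (simp add: tendsto_cong)
  then show ?thesis
    using equal tendsto_norm_zero_cancel by (fastforce simp: DERIV_def signed_powr_def)
qed

text \<open>Without interior critical points \<open>P\<close> is monotone, so the integral of the
  modulus is the modulus of the integral, that is |F(P b) - F(P a)| with F' = |s|^(q-1). Each value
  of F is at most B^q / q in modulus.\<close>

lemma has_integral_abs_powr_poly_deriv_no_critical:
  fixes P :: "real poly" and q B :: real
  assumes q: "q > 0" and ab: "a \<le> b" and P: "pderiv P \<noteq> 0"
    and B: "\<And>t. t \<in> {a..b} \<Longrightarrow> \<bar>poly P t\<bar> \<le> B"
    and nz: "\<And>t. t \<in> {a<..<b} \<Longrightarrow> poly (pderiv P) t \<noteq> 0"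
  shows "\<exists>I. ((\<lambda>t. \<bar>poly P t\<bar> powr (q - 1) * \<bar>poly (pderiv P) t\<bar>) has_integral I) {a..b}
    \<and> I \<le> 2 * B powr q / q"
proof -
  define F where "F s = signed_powr q s / q" for s
  have contF: "continuous_on UNIV F"
    unfolding F_def[abs_def] using q by (intro continuous_intros continuous_on_signed_powr) auto
  have derF: "(F has_real_derivative \<bar>s\<bar> powr (q - 1)) (at s)" if "s \<noteq> 0" for s
    unfolding F_def[abs_def] using DERIV_cdivide[OF has_real_derivative_signed_powr[OF that], of q q] q by simp
  have P0: "P \<noteq> 0" using P by auto
  have hasI: "((\<lambda>t. \<bar>poly P t\<bar> powr (q - 1) * poly (pderiv P) t) has_integral
      F (poly P b) - F (poly P a)) {a..b}"
  \<comment> \<open>This form of the fundamental theorem tolerates finitely many exceptional points.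
    They are the zeros of \<open>P\<close>, where \<open>F\<close> is merely continuous and the
    integrand may be singular.\<close>
  proof (rule fundamental_theorem_of_calculus_interior_strong[where S = "{t. poly P t = 0}"])
    show "finite {t. poly P t = 0}" using P0 by (rule poly_roots_finite)
    show "continuous_on {a..b} (\<lambda>t. F (poly P t))"
      by (rule continuous_on_compose2[OF contF]) (auto intro!: continuous_intros)
    fix t assume "t \<in> {a<..<b} - {t. poly P t = 0}"
    then show "((\<lambda>t. F (poly P t)) has_vector_derivative
        \<bar>poly P t\<bar> powr (q - 1) * poly (pderiv P) t) (at t)"
      using DERIV_chain[OF derF poly_DERIV, of P t]
      by (auto simp: o_def has_real_derivative_iff_has_vector_derivative)
  qed (use ab in auto)
  have Fb: "\<bar>F (poly P t)\<bar> \<le> B powr q / q" if "t \<in> {a..b}" for t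
  proof -
    have "\<bar>F s\<bar> = \<bar>s\<bar> powr q / q" for s
      using q by (simp add: F_def abs_signed_powr)
    moreover have "\<bar>poly P t\<bar> powr q \<le> B powr q"
      using B[OF that] q by (intro powr_mono2) auto
    ultimately show ?thesis using q by (simp add: divide_right_mono)
  qed
  have Fa: "\<bar>F (poly P b) - F (poly P a)\<bar> \<le> 2 * B powr q / q"
    using Fb[of a] Fb[of b] ab by auto
  \<comment> \<open>Intermediate value theorem: a derivative without zeros keeps its sign on the
    interval.\<close>
  have "(\<forall>t\<in>{a<..<b}. poly (pderiv P) t > 0) \<or> (\<forall>t\<in>{a<..<b}. poly (pderiv P) t < 0)"
  proof (rule ccontr)
    assume "\<not> ?thesis"
    then obtain s t where st: "s \<in> {a<..<b}" "t \<in> {a<..<b}"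
      "poly (pderiv P) s < 0" "poly (pderiv P) t > 0"
      using nz by (metis linorder_neqE_linordered_idom)
    then have "connected (poly (pderiv P) ` {a<..<b})"
      by (intro connected_continuous_image continuous_intros) auto
    then have "0 \<in> poly (pderiv P) ` {a<..<b}"
      using st by (meson connected_contains_Icc[THEN subsetD] atLeastAtMost_iff imageI less_imp_le)
    then show False using nz by auto
  qed
  then show ?thesis
  proof
    assume pos: "\<forall>t\<in>{a<..<b}. poly (pderiv P) t > 0"
    have "((\<lambda>t. \<bar>poly P t\<bar> powr (q - 1) * \<bar>poly (pderiv P) t\<bar>) has_integral
      F (poly P b) - F (poly P a)) {a..b}"
      by (rule has_integral_spike_finite[OF _ _ hasI, of "{a, b}"]) (use pos in \<open>auto simp: less_imp_le\<close>)
    then show ?thesis using Fa by auto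
  next
    assume neg: "\<forall>t\<in>{a<..<b}. poly (pderiv P) t < 0"
    have "((\<lambda>t. \<bar>poly P t\<bar> powr (q - 1) * \<bar>poly (pderiv P) t\<bar>) has_integral
      - (F (poly P b) - F (poly P a))) {a..b}"
      by (rule has_integral_spike_finite[OF _ _ has_integral_neg[OF hasI], of "{a, b}"])
        (use neg in \<open>auto simp: abs_of_neg\<close>)
    then show ?thesis using Fa by fastforce
  qed
qed

text \<open>Cutting at the k interior critical points gives k + 1 monotone pieces, each contributing
  at most 2 B^q / q. The induction is strong because a cut distributes the remaining critical points
  over two halves in an unknown way.\<close>

lemma has_integral_abs_powr_poly_deriv:
  fixes P :: "real poly" and q B :: real
  assumes q: "q > 0" and P: "pderiv P \<noteq> 0"
    and "a \<le> b" and "\<And>t. t \<in> {a..b} \<Longrightarrow> \<bar>poly P t\<bar> \<le> B"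
    and "card {t \<in> {a<..<b}. poly (pderiv P) t = 0} = k"
  shows "\<exists>I. ((\<lambda>t. \<bar>poly P t\<bar> powr (q - 1) * \<bar>poly (pderiv P) t\<bar>) has_integral I) {a..b}
    \<and> I \<le> (real k + 1) * (2 * B powr q / q)"
  using assms(3-)
proof (induction k arbitrary: a b rule: less_induct)
  case (less k)
  let ?Z = "\<lambda>a b. {t \<in> {a<..<b}. poly (pderiv P) t = 0}"
  have fin: "finite (?Z a b)" for a b
    using poly_roots_finite[OF P] by (rule finite_subset[rotated]) auto
  show ?case
  proof (cases "?Z a b = {}")
    case True
    then have "k = 0" using less.prems(3) by (metis card.empty)
    then show ?thesis
      using has_integral_abs_powr_poly_deriv_no_critical[OF q less.prems(1) P less.prems(2)] True
      by auto
  next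
    case False
    then obtain c where c: "a < c" "c < b" "poly (pderiv P) c = 0" by auto
    \<comment> \<open>The cut point lies in neither open half, so both counts are smaller than
      \<open>k\<close>, and the numbers of pieces add up: (k1 + 1) + (k2 + 1) = k + 1.\<close>
    have un: "?Z a b = insert c (?Z a c \<union> ?Z c b)" using c by auto
    have "card (?Z a b) = Suc (card (?Z a c \<union> ?Z c b))"
      unfolding un using fin by (intro card_insert_disjoint) auto
    also have "card (?Z a c \<union> ?Z c b) = card (?Z a c) + card (?Z c b)"
      using fin by (intro card_Un_disjoint) auto
    finally have k: "k = Suc (card (?Z a c) + card (?Z c b))" using less.prems by simp
    obtain I where I: "((\<lambda>t. \<bar>poly P t\<bar> powr (q - 1) * \<bar>poly (pderiv P) t\<bar>) has_integral I) {a..c}"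
      "I \<le> (real (card (?Z a c)) + 1) * (2 * B powr q / q)"
      using less.IH[of "card (?Z a c)" a c] k c less.prems by auto
    obtain J where J: "((\<lambda>t. \<bar>poly P t\<bar> powr (q - 1) * \<bar>poly (pderiv P) t\<bar>) has_integral J) {c..b}"
      "J \<le> (real (card (?Z c b)) + 1) * (2 * B powr q / q)"
      using less.IH[of "card (?Z c b)" c b] k c less.prems by auto
    have "((\<lambda>t. \<bar>poly P t\<bar> powr (q - 1) * \<bar>poly (pderiv P) t\<bar>) has_integral (I + J)) {a..b}"
      using I J c by (intro has_integral_combine[of a c b]) auto
    moreover have "I + J \<le> (real k + 1) * (2 * B powr q / q)"
      using I(2) J(2) add_mono[OF I(2) J(2)] unfolding k distrib_right[symmetric] by simp
    ultimately show ?thesis by blast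
  qed
qed

text \<open>The bound depends on \<open>P\<close> only through its degree and its size, so it is the
  same for all lines meeting a fixed ball. The form with a nonnegative integral suits Tonelli's
  theorem; for constant \<open>P\<close> the integrand is 0.\<close>

lemma nn_integral_abs_powr_poly_deriv_le:
  fixes P :: "real poly" and q B :: real
  assumes q: "q > 0" and deg: "degree P \<le> M"
    and B: "\<And>t. t \<in> {0..1} \<Longrightarrow> \<bar>poly P t\<bar> \<le> B"
  shows "(\<integral>\<^sup>+t. ennreal (indicator {0..1} t * (\<bar>poly P t\<bar> powr (q - 1) * \<bar>poly (pderiv P) t\<bar>)) \<partial>lborel)
    \<le> ennreal ((real M + 1) * (2 * B powr q / q))"
proof (cases "pderiv P = 0")
  case False
  let ?Z = "{t \<in> {0<..<1}. poly (pderiv P) t = 0}"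
  have "card ?Z \<le> card {t. poly (pderiv P) t = 0}"
    using poly_roots_finite[OF False] by (intro card_mono) auto
  also have "\<dots> \<le> M"
    using card_poly_roots_bound[OF False] deg degree_pderiv[of P] by linarith
  finally have card: "card ?Z \<le> M" .
  obtain I where I: "((\<lambda>t. \<bar>poly P t\<bar> powr (q - 1) * \<bar>poly (pderiv P) t\<bar>) has_integral I) {0..1}"
    "I \<le> (real (card ?Z) + 1) * (2 * B powr q / q)"
    using has_integral_abs_powr_poly_deriv[OF q False, of 0 1 B] B by auto
  have "I \<le> (real M + 1) * (2 * B powr q / q)"
    using I(2) card q by (elim order.trans, intro mult_right_mono) auto
  moreover have "(\<integral>\<^sup>+t. ennreal (indicator {0..1} t * (\<bar>poly P t\<bar> powr (q - 1) * \<bar>poly (pderiv P) t\<bar>)) \<partial>lborel) = ennreal I"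
    using I(1) by (intro nn_integral_has_integral_lebesgue) auto
  ultimately show ?thesis by (simp add: ennreal_leI)
qed auto

subsection \<open>Functions that are polynomial along lines\<close>

text \<open>The degree bound \<open>M\<close> is common to all lines; a bound depending on the line
  would not give a uniform number of monotone pieces.\<close>

definition poly_on_lines :: "nat \<Rightarrow> ('a::real_vector \<Rightarrow> real) \<Rightarrow> bool" where
  "poly_on_lines M f \<longleftrightarrow> (\<forall>a b. \<exists>P. degree P \<le> M \<and> (\<forall>t. f (a + t *\<^sub>R b) = poly P t))"

lemma nn_integral_lborel_translate:
  fixes f :: "'a::euclidean_space \<Rightarrow> ennreal"
  assumes [measurable]: "f \<in> borel_measurable borel"
  shows "(\<integral>\<^sup>+x. f (x + a) \<partial>lborel) = (\<integral>\<^sup>+x. f x \<partial>lborel)"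
proof -
  have "(\<integral>\<^sup>+x. f x \<partial>lborel) = (\<integral>\<^sup>+x. f x \<partial>distr lborel borel ((+) a))"
    by (simp add: lborel_distr_plus)
  also have "\<dots> = (\<integral>\<^sup>+x. f (x + a) \<partial>lborel)"
    by (subst nn_integral_distr) (auto simp: add.commute)
  finally show ?thesis by simp
qed

lemma has_real_derivative_along_line:
  fixes f :: "'a::real_normed_vector \<Rightarrow> real"
  assumes f': "\<And>x. (f has_derivative f' x) (at x)"
  shows "((\<lambda>t. f (x + t *\<^sub>R v)) has_real_derivative f' (x + t *\<^sub>R v) v) (at t)"
proof -
  have "((\<lambda>t. f (x + t *\<^sub>R v)) has_derivative (\<lambda>s. f' (x + t *\<^sub>R v) (s *\<^sub>R v))) (at t)"
    by (rule has_derivative_compose[OF _ f']) (auto intro!: derivative_eq_intros)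
  moreover have "f' (x + t *\<^sub>R v) (s *\<^sub>R v) = f' (x + t *\<^sub>R v) v * s" for s
    using linear_cmul[OF has_derivative_linear[OF f']] by (simp add: mult.commute)
  ultimately show ?thesis by (simp add: has_field_derivative_def mult_commute_abs)
qed

lemma deriv_poly_on_line:
  fixes f :: "'a::real_normed_vector \<Rightarrow> real"
  assumes f': "\<And>x. (f has_derivative f' x) (at x)"
    and P: "\<And>t. f (x + t *\<^sub>R e) = poly P t"
  shows "f' (x + t *\<^sub>R e) e = poly (pderiv P) t"
  using DERIV_unique[OF has_real_derivative_along_line[OF f', of x e t]] poly_DERIV[of P t]
  by (simp add: P)

text \<open>Averaging over translates along \<open>e\<close> reduces the bound to the one-dimensional one.\<close>

lemma integrable_poly_on_lines_powr_deriv: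
  fixes f :: "'a::euclidean_space \<Rightarrow> real"
  assumes q: "q > 0" and f: "poly_on_lines M f"
    and f': "\<And>x. (f has_derivative f' x) (at x)"
    and cont: "continuous_on UNIV (\<lambda>x. f' x e)"
  shows "integrable lborel (\<lambda>x. indicator (cball 0 R) x * (\<bar>f x\<bar> powr (q - 1) * \<bar>f' x e\<bar>))"
proof -
  define \<phi> where "\<phi> x = \<bar>f x\<bar> powr (q - 1) * \<bar>f' x e\<bar>" for x
  have contf: "continuous_on UNIV f"
    using f' has_derivative_continuous_on[of UNIV f f'] by auto
  have [measurable]: "f \<in> borel_measurable borel" "(\<lambda>x. f' x e) \<in> borel_measurable borel"
    using contf cont by (auto intro: borel_measurable_continuous_onI)
  have [measurable]: "\<phi> \<in> borel_measurable borel" unfolding \<phi>_def by measurable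
  \<comment> \<open>If x + t e lies in the ball of radius R for some t in [0,1], then x lies in the
    ball of radius R + |e|, later \<open>K'\<close>; from such x the whole segment stays within
    radius R + 2|e|.\<close>
  have "compact (f ` cball 0 (R + 2 * norm e))"
    by (intro compact_continuous_image continuous_on_subset[OF contf]) auto
  then obtain B where B: "\<And>x. x \<in> cball 0 (R + 2 * norm e) \<Longrightarrow> \<bar>f x\<bar> \<le> B"
    by (metis bounded_real compact_imp_bounded imageI)
  define C where "C = (real M + 1) * (2 * B powr q / q)"
  define K' :: "'a set" where "K' = cball 0 (R + norm e)"
  define g :: "'a \<Rightarrow> ennreal" where "g x = ennreal (indicator (cball 0 R) x * \<phi> x)" for x
  have [measurable]: "cball (0 :: 'a) R \<in> sets borel" by simp
  have [measurable]: "g \<in> borel_measurable borel" unfolding g_def by measurable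
  have line: "(\<integral>\<^sup>+t. ennreal (indicator {0..1} t * \<phi> (x + t *\<^sub>R e)) \<partial>lborel) \<le> ennreal C"
    if "x \<in> K'" for x
  proof -
    obtain P where P: "degree P \<le> M" "\<And>t. f (x + t *\<^sub>R e) = poly P t"
      using f unfolding poly_on_lines_def by blast
    have "\<bar>poly P t\<bar> \<le> B" if t: "t \<in> {0..1}" for t
    proof -
      have "norm (x + t *\<^sub>R e) \<le> norm x + \<bar>t\<bar> * norm e" by (metis norm_scaleR norm_triangle_ineq)
      also have "\<dots> \<le> norm x + 1 * norm e" using t by (intro add_left_mono mult_right_mono) auto
      also have "\<dots> \<le> R + 2 * norm e" using \<open>x \<in> K'\<close> by (auto simp: K'_def)
      finally show ?thesis using B[of "x + t *\<^sub>R e"] P(2) by simp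
    qed
    then show ?thesis
      using nn_integral_abs_powr_poly_deriv_le[OF q P(1), of B]
      unfolding \<phi>_def C_def P(2) deriv_poly_on_line[OF f' P(2)] by simp
  qed
  \<comment> \<open>The interval [0,1] has length 1, so averaging over t changes nothing. Then x is
    translated by t e separately for each t, and Tonelli makes the integral over the line the inner
    one.\<close>
  have "(\<integral>\<^sup>+x. g x \<partial>lborel) = (\<integral>\<^sup>+t. indicator {0..1} t * (\<integral>\<^sup>+x. g x \<partial>lborel) \<partial>(lborel :: real measure))"
    by (subst nn_integral_multc) auto
  also have "\<dots> = (\<integral>\<^sup>+t. indicator {0..1} t * (\<integral>\<^sup>+x. g (x + t *\<^sub>R e) \<partial>lborel) \<partial>(lborel :: real measure))"
    by (subst nn_integral_lborel_translate) auto
  also have "\<dots> = (\<integral>\<^sup>+t. (\<integral>\<^sup>+x. indicator {0..1} t * g (x + t *\<^sub>R e) \<partial>lborel) \<partial>(lborel :: real measure))"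
    by (subst nn_integral_cmult) auto
  also have "\<dots> = (\<integral>\<^sup>+x. (\<integral>\<^sup>+t. indicator {0..1} t * g (x + t *\<^sub>R e) \<partial>(lborel :: real measure)) \<partial>lborel)"
    by (rule lborel_pair.Fubini') measurable
  also have "\<dots> \<le> (\<integral>\<^sup>+x. ennreal C * indicator K' x \<partial>lborel)"
  proof (rule nn_integral_mono)
    fix x :: 'a
    show "(\<integral>\<^sup>+t. indicator {0..1} t * g (x + t *\<^sub>R e) \<partial>(lborel :: real measure)) \<le> ennreal C * indicator K' x"
    proof (cases "x \<in> K'")
      case True
      have "(\<integral>\<^sup>+t. indicator {0..1} t * g (x + t *\<^sub>R e) \<partial>(lborel :: real measure))
          \<le> (\<integral>\<^sup>+t. ennreal (indicator {0..1} t * \<phi> (x + t *\<^sub>R e)) \<partial>lborel)"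
        by (rule nn_integral_mono) (auto simp: g_def indicator_def \<phi>_def)
      also have "\<dots> \<le> ennreal C" by (rule line[OF True])
      finally show ?thesis using True by simp
    next
      case False
      have "indicator {0..1} t * g (x + t *\<^sub>R e) = 0" for t :: real
      proof (cases "t \<in> {0..1}")
        case True
        have "norm x \<le> norm (x + t *\<^sub>R e) + norm (t *\<^sub>R e)"
          by (metis add_diff_cancel norm_triangle_ineq4)
        also have "norm (t *\<^sub>R e) \<le> norm e" using True by (auto simp: mult_left_le_one_le)
        finally have "x + t *\<^sub>R e \<notin> cball 0 R" using False by (auto simp: K'_def)
        then show ?thesis by (simp add: g_def)
      qed auto
      then have "(\<lambda>t. indicator {0..1} t * g (x + t *\<^sub>R e)) = (\<lambda>t::real. 0)" by (rule ext)
      then show ?thesis by (simp only: nn_integral_const) simp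
    qed
  qed
  also have "\<dots> = ennreal C * emeasure lborel K'"
    by (subst nn_integral_cmult_indicator) (auto simp: K'_def)
  also have "\<dots> < \<infinity>"
    using emeasure_lborel_cball_finite[of 0 "R + norm e"] by (auto simp: K'_def ennreal_mult_less_top)
  finally show ?thesis
    by (intro integrableI_bounded) (auto simp: g_def \<phi>_def)
qed

text \<open>On every line through \<open>a\<close> the restriction is a nonzero polynomial, so it
  has finitely many zeros. By Tonelli, for almost every t the set of x with f(a + t x) = 0 is null;
  for one t \<noteq> 0 an affine bijection carries that set onto the zero set.\<close>

lemma negligible_zeros_poly_on_lines:
  fixes f :: "'a::euclidean_space \<Rightarrow> real"
  assumes f: "poly_on_lines M f" and cont: "continuous_on UNIV f" and a: "f a \<noteq> 0"
  shows "negligible {x. f x = 0}"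
proof -
  define S where "S = {x. f x = 0}"
  have "closed S"
    unfolding S_def using continuous_closed_preimage_constant[OF cont, of 0] by (simp add: vimage_def)
  then have [measurable]: "S \<in> sets borel" by simp
  define g :: "'a \<Rightarrow> real \<Rightarrow> ennreal" where "g x t = indicator {0<..<1} t * indicator S (a + t *\<^sub>R x)" for x t
  have "(\<lambda>z. a + snd z *\<^sub>R fst z) -` S \<in> sets (borel :: ('a \<times> real) measure)"
    by (intro borel_closed closed_vimage \<open>closed S\<close> continuous_intros)
  then have "(\<lambda>z. a + snd z *\<^sub>R fst z) -` S \<in> sets (lborel \<Otimes>\<^sub>M lborel :: ('a \<times> real) measure)"
    by (simp only: lborel_prod sets_lborel)
  then have "(\<lambda>z. indicator ((\<lambda>z. a + snd z *\<^sub>R fst z) -` S) z :: ennreal) \<in> borel_measurable (lborel \<Otimes>\<^sub>M lborel :: ('a \<times> real) measure)"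
    by measurable
  then have [measurable]: "case_prod g \<in> borel_measurable (lborel \<Otimes>\<^sub>M lborel)"
    unfolding g_def by (simp add: indicator_def case_prod_unfold) 
  have "(\<integral>\<^sup>+t. (\<integral>\<^sup>+x. g x t \<partial>lborel) \<partial>lborel) = (\<integral>\<^sup>+x. (\<integral>\<^sup>+t. g x t \<partial>lborel) \<partial>lborel)"
    by (rule lborel_pair.Fubini') measurable
  also have "\<dots> = (\<integral>\<^sup>+x. 0 \<partial>(lborel :: 'a measure))"
  proof (rule nn_integral_cong)
    fix x :: 'a
    obtain P where P: "\<And>t. f (a + t *\<^sub>R x) = poly P t"
      using f unfolding poly_on_lines_def by blast
    have "P \<noteq> 0" using P[of 0] a by auto
    then have "finite {t. a + t *\<^sub>R x \<in> S}"
      using poly_roots_finite[of P] by (simp add: S_def P)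
    then have "AE t in lborel. t \<notin> {t. a + t *\<^sub>R x \<in> S}"
      by (intro AE_not_in finite_imp_null_set_lborel)
    then have "AE t in lborel. g x t = 0"
      by eventually_elim (auto simp: g_def)
    then show "(\<integral>\<^sup>+t. g x t \<partial>lborel) = 0"
      by (subst nn_integral_0_iff_AE) auto
  qed
  finally have "(\<integral>\<^sup>+t. (\<integral>\<^sup>+x. g x t \<partial>lborel) \<partial>lborel) = 0" by simp
  then have "AE t in lborel. (\<integral>\<^sup>+x. g x t \<partial>lborel) = 0"
    by (subst (asm) nn_integral_0_iff_AE) auto
  \<comment> \<open>The interval (0,1) is not null, so the exceptional values of t cannot fill it.
    Choosing t there keeps it away from 0, where the affine map degenerates.\<close>
  moreover have "\<not> (AE t in lborel. t \<notin> {0<..<1::real})"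
    by (subst AE_iff_measurable[of "{0<..<1}"]) auto
  ultimately obtain t where t: "t \<in> {0<..<1}" "(\<integral>\<^sup>+x. g x t \<partial>lborel) = 0"
    by (metis (mono_tags, lifting) AE_mp AE_I2)
  have [measurable]: "(\<lambda>x. g x t) \<in> borel_measurable lborel" unfolding g_def by measurable
  have "AE x in lborel. g x t = 0"
    using t by (subst (asm) nn_integral_0_iff_AE) auto
  then have ae: "AE x in lborel. \<not> a + t *\<^sub>R x \<in> S"
    by eventually_elim (use t in \<open>auto simp: g_def indicator_def\<close>)
  have "{x. a + t *\<^sub>R x \<in> S} \<in> null_sets lborel"
    by (subst AE_iff_null_sets) (use ae in auto)
  then have "negligible {x. a + t *\<^sub>R x \<in> S}"
    by (simp add: negligible_iff_null_sets null_sets_completionI)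
  then have "negligible ((\<lambda>x. a + t *\<^sub>R x) ` {x. a + t *\<^sub>R x \<in> S})"
    by (intro negligible_differentiable_image_negligible differentiable_on_add differentiable_on_const
        linear_imp_differentiable_on linear_scaleR) auto
  moreover have "S \<subseteq> (\<lambda>x. a + t *\<^sub>R x) ` {x. a + t *\<^sub>R x \<in> S}"
  proof
    fix y assume "y \<in> S"
    then have "y = a + t *\<^sub>R ((1 / t) *\<^sub>R (y - a))" using t by simp
    then show "y \<in> (\<lambda>x. a + t *\<^sub>R x) ` {x. a + t *\<^sub>R x \<in> S}"
      using \<open>y \<in> S\<close> by (metis (mono_tags, lifting) imageI mem_Collect_eq)
  qed
  ultimately show ?thesis using negligible_subset unfolding S_def by blast
qed

text \<open>Difference quotients of \<open>h\<close> have integral 0 by translation invariance, and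
  they converge dominatedly to the derivative, the mean value theorem supplying the bound. This
  treats any direction \<open>v\<close> without splitting off a coordinate.\<close>

lemma integral_directional_deriv_eq_0:
  fixes h :: "'a::euclidean_space \<Rightarrow> real"
  assumes h': "\<And>x. (h has_derivative h' x) (at x)"
    and cont: "continuous_on UNIV (\<lambda>x. h' x v)"
    and supp: "compact K" "\<And>x. x \<notin> K \<Longrightarrow> h x = 0"
  shows "integrable lborel (\<lambda>x. h' x v)" "(\<integral>x. h' x v \<partial>lborel) = 0"
proof -
  obtain R where R: "R > 0" "K \<subseteq> cball 0 R"
    using compact_imp_bounded[OF supp(1)] using bounded_subset_ballD ball_subset_cball by (metis order.trans)
  \<comment> \<open>The steps 1/(n+1) are at most 1, so all difference quotients vanish outside this
    ball, and the intermediate points of the mean value theorem stay within radius R + 2|v|.\<close>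
  define K' :: "'a set" where "K' = cball 0 (R + norm v)"
  have contdh: "continuous_on UNIV h"
    using h' has_derivative_continuous_on[of UNIV h h'] by auto
  have "compact ((\<lambda>x. h' x v) ` cball 0 (R + 2 * norm v))"
    by (intro compact_continuous_image continuous_on_subset[OF cont]) auto
  then obtain B where B: "\<And>x. x \<in> cball 0 (R + 2 * norm v) \<Longrightarrow> \<bar>h' x v\<bar> \<le> B"
    by (metis bounded_real compact_imp_bounded imageI)
  define D where "D n x = real (Suc n) * (h (x + (1 / real (Suc n)) *\<^sub>R v) - h x)" for n x
  have bound: "\<bar>D n x\<bar> \<le> indicator K' x * B" for n x
  proof -
    let ?s = "1 / real (Suc n)"
    have s: "0 < ?s" "?s \<le> 1" by auto
    obtain z where z: "0 < z" "z < ?s" "h (x + ?s *\<^sub>R v) - h (x + 0 *\<^sub>R v) = (?s - 0) * h' (x + z *\<^sub>R v) v"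
      using MVT2[OF s(1), of "\<lambda>t. h (x + t *\<^sub>R v)" "\<lambda>t. h' (x + t *\<^sub>R v) v"]
        has_real_derivative_along_line[OF h'] by blast
    then have D: "D n x = h' (x + z *\<^sub>R v) v" by (simp add: D_def)
    show ?thesis
    proof (cases "x \<in> K'")
      case True
      have "norm (x + z *\<^sub>R v) \<le> norm x + norm (z *\<^sub>R v)" by (rule norm_triangle_ineq)
      also have "norm (z *\<^sub>R v) \<le> norm v"
        using z(1) less_le_trans[OF z(2) s(2)] by (auto simp: mult_left_le_one_le)
      finally have "x + z *\<^sub>R v \<in> cball 0 (R + 2 * norm v)" using True by (auto simp: K'_def)
      then show ?thesis using B D True by simp
    next
      case False
      have "h (x + t *\<^sub>R v) = 0" if "0 \<le> t" "t \<le> 1" for t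
      proof -
        have "norm x \<le> norm (x + t *\<^sub>R v) + norm (t *\<^sub>R v)"
          by (metis add_diff_cancel norm_triangle_ineq4)
        also have "norm (t *\<^sub>R v) \<le> norm v" using that by (auto simp: mult_left_le_one_le)
        finally have "x + t *\<^sub>R v \<notin> cball 0 R" using False by (auto simp: K'_def)
        then show ?thesis using supp R by blast
      qed
      from this[of 0] this[of ?s] s have "D n x = 0" by (simp add: D_def)
      then show ?thesis using False by simp
    qed
  qed
  have lim: "(\<lambda>n. D n x) \<longlonglongrightarrow> h' x v" for x
  proof -
    have "((\<lambda>s. (h (x + s *\<^sub>R v) - h x) / s) \<longlongrightarrow> h' x v) (at 0)"
      using has_real_derivative_along_line[OF h', of x v 0] by (simp add: DERIV_def)
    moreover have "filterlim (\<lambda>n. 1 / real (Suc n)) (at 0) sequentially"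
      using LIMSEQ_inverse_real_of_nat by (intro filterlim_atI) (auto simp: inverse_eq_divide)
    ultimately have "(\<lambda>n. (h (x + (1 / real (Suc n)) *\<^sub>R v) - h x) / (1 / real (Suc n))) \<longlonglongrightarrow> h' x v"
      by (rule filterlim_compose)
    then show ?thesis by (simp add: D_def mult.commute)
  qed
  have inth: "integrable lborel h"
  proof -
    have "integrable lborel (\<lambda>x. indicator K x *\<^sub>R h x)"
      by (intro borel_integrable_compact supp continuous_on_subset[OF contdh]) auto
    moreover have "(\<lambda>x. indicator K x *\<^sub>R h x) = h" using supp(2) by (auto simp: indicator_def fun_eq_iff)
    ultimately show ?thesis by simp
  qed
  have inttr: "integrable lborel (\<lambda>x. h (x + a))" "(\<integral>x. h (x + a) \<partial>lborel) = (\<integral>x. h x \<partial>lborel)" for a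
  proof -
    have [measurable]: "h \<in> borel_measurable borel" using contdh by (rule borel_measurable_continuous_onI)
    have "integrable (distr lborel borel ((+) a)) h" using inth by (simp add: lborel_distr_plus)
    then show "integrable lborel (\<lambda>x. h (x + a))"
      by (subst (asm) integrable_distr_eq) (auto simp: add.commute)
    have "(\<integral>x. h x \<partial>lborel) = (\<integral>x. h x \<partial>distr lborel borel ((+) a))" by (simp add: lborel_distr_plus)
    also have "\<dots> = (\<integral>x. h (x + a) \<partial>lborel)" by (subst integral_distr) (auto simp: add.commute)
    finally show "(\<integral>x. h (x + a) \<partial>lborel) = (\<integral>x. h x \<partial>lborel)" by simp
  qed
  have D0: "(\<integral>x. D n x \<partial>lborel) = 0" for n
    using inttr[of "(1 / real (Suc n)) *\<^sub>R v"] inth unfolding D_def by simp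
  have mD: "D n \<in> borel_measurable lborel" for n
    unfolding D_def using inttr(1) inth by (intro borel_measurable_times borel_measurable_diff) auto
  have mh': "(\<lambda>x. h' x v) \<in> borel_measurable lborel"
    using cont by (simp add: borel_measurable_continuous_onI)
  have intB: "integrable lborel (\<lambda>x. indicator K' x * B)"
    using emeasure_lborel_cball_finite[of 0 "R + norm v"]
    by (intro integrable_mult_left integrable_real_indicator) (auto simp: K'_def)
  note dct = mh' mD intB AE_I2[OF lim] AE_I2[of lborel, OF bound[folded real_norm_def]]
  show "integrable lborel (\<lambda>x. h' x v)"
    by (rule integrable_dominated_convergence[OF dct])
  show "(\<integral>x. h' x v \<partial>lborel) = 0"
    using LIMSEQ_unique[OF integral_dominated_convergence[OF dct]] D0 by auto
qed

subsection \<open>Homogeneity of the Jacobian generators\<close>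

lemma smooth_on_has_derivative:
  assumes "smooth_on UNIV f"
  shows "(f has_derivative frechet_derivative f (at x)) (at x)"
proof -
  have "times_differentiable_on (Suc 0) UNIV f" using assms unfolding smooth_on_def by blast
  then show ?thesis by (simp add: frechet_derivative_works)
qed

lemma smooth_on_directional_deriv:
  "smooth_on UNIV f \<Longrightarrow> smooth_on UNIV (\<lambda>x. frechet_derivative f (at x) v)"
  unfolding smooth_on_def by (metis times_differentiable_on.simps(2))

lemma smooth_on_continuous: "smooth_on S f \<Longrightarrow> continuous_on S f"
  unfolding smooth_on_def by (metis times_differentiable_on.simps(1))

text \<open>The class of such composites is closed under differentiation: the derivative in
  direction v is \<open>B\<close> applied to the derivative of \<open>f\<close> in the fixed
  direction \<open>A v\<close>, again at \<open>A x + c\<close>. So the induction needs no product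
  terms.\<close>

lemma times_differentiable_on_compose_affine:
  assumes A: "bounded_linear A" and B: "bounded_linear B"
  shows "times_differentiable_on n UNIV f \<Longrightarrow> times_differentiable_on n UNIV (\<lambda>x. B (f (A x + c)))"
proof (induction n arbitrary: f)
  case 0
  have "continuous_on UNIV (\<lambda>x. A x + c)"
    by (intro continuous_intros linear_continuous_on A)
  then have "continuous_on UNIV (\<lambda>x. f (A x + c))"
    using 0 continuous_on_compose2[of UNIV f _ "\<lambda>x. A x + c"] by auto
  then show ?case
    using continuous_on_compose2[OF linear_continuous_on[OF B]] by auto
next
  case (Suc n)
  have der: "((\<lambda>x. B (f (A x + c))) has_derivative (\<lambda>v. B (frechet_derivative f (at (A x + c)) (A v)))) (at x)" for x
  proof -
    have "(f has_derivative frechet_derivative f (at (A x + c))) (at (A x + c))"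
      using Suc.prems by (simp add: frechet_derivative_works)
    moreover have "((\<lambda>x. A x + c) has_derivative A) (at x)"
      using bounded_linear.has_derivative[OF A has_derivative_ident]
      by (auto intro!: derivative_eq_intros)
    ultimately have "((\<lambda>x. f (A x + c)) has_derivative (\<lambda>v. frechet_derivative f (at (A x + c)) (A v))) (at x)"
      using has_derivative_compose by blast
    then show ?thesis by (rule bounded_linear.has_derivative[OF B])
  qed
  have "times_differentiable_on n UNIV (\<lambda>x. B (frechet_derivative f (at (A x + c)) (A v)))" for v
    using Suc.IH[of "\<lambda>y. frechet_derivative f (at y) (A v)"] Suc.prems by simp
  moreover have "frechet_derivative (\<lambda>x. B (f (A x + c))) (at x) = (\<lambda>v. B (frechet_derivative f (at (A x + c)) (A v)))" for x
    using frechet_derivative_at[OF der] by simp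
  ultimately show ?case using der by (auto simp: differentiable_def)
qed

lemma smooth_on_compose_affine:
  "bounded_linear A \<Longrightarrow> bounded_linear B \<Longrightarrow> smooth_on UNIV f \<Longrightarrow> smooth_on UNIV (\<lambda>x. B (f (A x + c)))"
  unfolding smooth_on_def using times_differentiable_on_compose_affine by blast

text \<open>The degree is a real number since differentiation may push it below zero, which is
  precisely the case that forces a function to vanish.\<close>

definition homogeneous :: "('n::finite \<Rightarrow> nat) \<Rightarrow> real \<Rightarrow> (real^'n \<Rightarrow> real) \<Rightarrow> bool" where
  "homogeneous \<sigma> s f \<longleftrightarrow> (\<forall>t>0. \<forall>x. f (dilation \<sigma> t x) = t powr s * f x)"

lemma bounded_linear_dilation: "bounded_linear (dilation \<sigma> t)"
  unfolding linear_conv_bounded_linear[symmetric]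
  by (rule linearI) (auto simp: dilation_def vec_eq_iff algebra_simps)

lemma dilation_axis: "dilation \<sigma> t (axis j 1) = t ^ \<sigma> j *\<^sub>R axis j 1"
  by (auto simp: dilation_def vec_eq_iff axis_def)

text \<open>For t tending to 0 from above, f(x) = t^(-s) f(\<delta>_t x), where \<delta>_t x tends
  to 0 because all weights are positive. The second factor tends to f(0) and the first to 0.\<close>

lemma homogeneous_neg_eq_0:
  assumes hom: "homogeneous \<sigma> s f" and s: "s < 0" and \<sigma>: "\<And>j. \<sigma> j \<ge> 1"
    and cont: "continuous_on UNIV f"
  shows "f x = 0"
proof -
  have "((\<lambda>t. t ^ \<sigma> j * x $ j) \<longlongrightarrow> 0) (at_right 0)" for j
  proof -
    have "((\<lambda>t. t ^ \<sigma> j * x $ j) \<longlongrightarrow> 0 ^ \<sigma> j * x $ j) (at_right 0)"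
      by (intro tendsto_intros)
    moreover have "0 ^ \<sigma> j * x $ j = 0" using \<sigma>[of j] by (simp add: power_0_left)
    ultimately show ?thesis by (simp only:)
  qed
  then have "((\<lambda>t. dilation \<sigma> t x) \<longlongrightarrow> 0) (at_right 0)"
    by (intro vec_tendstoI) (simp add: dilation_def)
  then have "((\<lambda>t. f (dilation \<sigma> t x)) \<longlongrightarrow> f 0) (at_right 0)"
    using cont by (intro isCont_tendsto_compose[of 0 f]) (auto simp: continuous_on_eq_continuous_at)
  moreover have "((\<lambda>t. t powr (- s)) \<longlongrightarrow> 0) (at_right (0::real))"
  proof -
    have "\<forall>\<^sub>F t in at_right (0::real). 0 \<le> t"
      by (rule eventually_mono[OF eventually_at_right_less]) simp
    from tendsto_powr2[OF tendsto_ident_at tendsto_const this, of "- s"] s show ?thesis by simp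
  qed
  ultimately have "((\<lambda>t. t powr (- s) * f (dilation \<sigma> t x)) \<longlongrightarrow> 0 * f 0) (at_right 0)"
    by (intro tendsto_mult)
  moreover have "\<forall>\<^sub>F t in at_right 0. t powr (- s) * f (dilation \<sigma> t x) = f x"
    using hom by (intro eventually_at_rightI[of 0 1])
      (auto simp: homogeneous_def mult.assoc[symmetric] powr_add[symmetric])
  ultimately have "((\<lambda>t::real. f x) \<longlongrightarrow> 0) (at_right 0)"
    using tendsto_cong by fastforce
  then show ?thesis
    by (metis tendsto_const tendsto_unique trivial_limit_at_right_real)
qed

text \<open>Differentiating f(\<delta>_t x) = t^s f(x) in the direction of the j-th axis produces
  the factor t^(\<sigma> j) on the left, by which the degree drops.\<close>

lemma homogeneous_partial_deriv:
  assumes hom: "homogeneous \<sigma> s f" and f': "\<And>x. (f has_derivative f' x) (at x)"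
  shows "homogeneous \<sigma> (s - real (\<sigma> j)) (\<lambda>x. f' x (axis j 1))"
  unfolding homogeneous_def
proof (intro allI impI)
  fix t :: real and x assume t: "t > 0"
  have "((\<lambda>x. f (dilation \<sigma> t x)) has_derivative (\<lambda>v. f' (dilation \<sigma> t x) (dilation \<sigma> t v))) (at x)"
    by (rule has_derivative_compose[OF bounded_linear.has_derivative[OF bounded_linear_dilation has_derivative_ident] f'])
  moreover have "((\<lambda>x. f (dilation \<sigma> t x)) has_derivative (\<lambda>v. t powr s * f' x v)) (at x)"
    using hom t f' by (auto simp: homogeneous_def intro!: derivative_eq_intros)
  ultimately have "f' (dilation \<sigma> t x) (dilation \<sigma> t (axis j 1)) = t powr s * f' x (axis j 1)"
    by (metis has_derivative_unique)
  then have "t ^ \<sigma> j * f' (dilation \<sigma> t x) (axis j 1) = t powr s * f' x (axis j 1)"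
    using linear_cmul[OF has_derivative_linear[OF f']] by (simp add: dilation_axis)
  then show "f' (dilation \<sigma> t x) (axis j 1) = t powr (s - real (\<sigma> j)) * f' x (axis j 1)"
    using t by (simp add: powr_diff powr_realpow field_simps)
qed

lemma deriv_eq_sum_partial_derivs:
  fixes f' :: "real^'n \<Rightarrow> real"
  assumes "linear f'"
  shows "f' v = (\<Sum>j\<in>UNIV. v $ j * f' (axis j 1))"
proof -
  have "f' v = f' (\<Sum>j\<in>UNIV. v $ j *\<^sub>R axis j 1)"
    by (simp add: basis_expansion scalar_mult_eq_scaleR[symmetric])
  also have "\<dots> = (\<Sum>j\<in>UNIV. v $ j * f' (axis j 1))"
    by (simp add: linear_sum[OF assms] linear_cmul[OF assms])
  finally show ?thesis .
qed

lemma poly_antiderivative: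
  fixes Q :: "real poly"
  obtains P where "pderiv P = Q" "degree P \<le> Suc (degree Q)"
proof
  let ?P = "\<Sum>i\<le>degree Q. monom (coeff Q i / real (Suc i)) (Suc i)"
  show "pderiv ?P = Q"
    by (simp add: higher_pderiv_sum[of 1, simplified] pderiv_monom poly_as_sum_of_monoms del: of_nat_Suc)
  show "degree ?P \<le> Suc (degree Q)"
    by (intro degree_sum_le) (auto intro: order.trans[OF degree_monom_le])
qed

lemma poly_on_lines_sum:
  assumes "\<And>j. j \<in> A \<Longrightarrow> poly_on_lines M (f j)"
  shows "poly_on_lines M (\<lambda>x. \<Sum>j\<in>A. c j * f j x)"
  unfolding poly_on_lines_def
proof (intro allI)
  fix a b
  have "\<forall>j\<in>A. \<exists>P. degree P \<le> M \<and> (\<forall>t. f j (a + t *\<^sub>R b) = poly P t)"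
    using assms unfolding poly_on_lines_def by blast
  from bchoice[OF this] obtain P where P: "\<And>j. j \<in> A \<Longrightarrow> degree (P j) \<le> M"
      "\<And>j t. j \<in> A \<Longrightarrow> f j (a + t *\<^sub>R b) = poly (P j) t"
    by blast
  let ?P = "\<Sum>j\<in>A. smult (c j) (P j)"
  have "degree ?P \<le> M"
  proof (cases "finite A")
    case True
    then show ?thesis using P(1) by (intro degree_sum_le) (auto intro: order.trans[OF degree_smult_le])
  qed simp
  moreover have "(\<Sum>j\<in>A. c j * f j (a + t *\<^sub>R b)) = poly ?P t" for t
    by (simp add: poly_sum P(2))
  ultimately show "\<exists>P. degree P \<le> M \<and> (\<forall>t. (\<Sum>j\<in>A. c j * f j (a + t *\<^sub>R b)) = poly P t)"
    by blast
qed

text \<open>A partial derivative lowers the degree by at least 1, so \<open>s < M\<close> is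
  inherited with \<open>M - 1\<close>, and at \<open>M = 0\<close> the function has negative degree
  and vanishes. Back along a line: the derivative there is a combination of partial derivatives,
  hence polynomial, and its antiderivative gains one degree.\<close>

lemma homogeneous_poly_on_lines:
  fixes \<sigma> :: "'n::finite \<Rightarrow> nat"
  assumes \<sigma>: "\<And>j. \<sigma> j \<ge> 1"
  shows "smooth_on UNIV f \<Longrightarrow> homogeneous \<sigma> s f \<Longrightarrow> s < real M \<Longrightarrow> poly_on_lines M f"
proof (induction M arbitrary: f s)
  case 0
  then have "f x = 0" for x
    using homogeneous_neg_eq_0[OF "0.prems"(2) _ \<sigma> smooth_on_continuous[OF "0.prems"(1)]] by simp
  then show ?case unfolding poly_on_lines_def by (intro allI exI[of _ 0]) auto
next
  case (Suc M)
  let ?f' = "\<lambda>x. frechet_derivative f (at x)"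
  have f': "(f has_derivative ?f' x) (at x)" for x
    by (rule smooth_on_has_derivative[OF Suc.prems(1)])
  have IH: "poly_on_lines M (\<lambda>x. ?f' x (axis j 1))" for j
    using Suc.prems(3) \<sigma>[of j]
    by (intro Suc.IH[OF smooth_on_directional_deriv[OF Suc.prems(1)] homogeneous_partial_deriv[OF Suc.prems(2) f']]) linarith
  show ?case unfolding poly_on_lines_def
  proof (intro allI)
    fix a b
    have "poly_on_lines M (\<lambda>x. \<Sum>j\<in>UNIV. b $ j * ?f' x (axis j 1))"
      by (intro poly_on_lines_sum IH)
    then have "poly_on_lines M (\<lambda>x. ?f' x b)"
      by (subst deriv_eq_sum_partial_derivs[OF has_derivative_linear[OF f']])
    then obtain Q where Q: "degree Q \<le> M" "\<And>t. ?f' (a + t *\<^sub>R b) b = poly Q t"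
      unfolding poly_on_lines_def by blast
    obtain P where P: "pderiv P = Q" "degree P \<le> Suc (degree Q)" by (rule poly_antiderivative)
    have "((\<lambda>t. f (a + t *\<^sub>R b) - poly P t) has_real_derivative 0) (at t)" for t
      using DERIV_diff[OF has_real_derivative_along_line[OF f', of a b t] poly_DERIV[of P t]] by (simp add: P(1) Q(2))
    then have const: "f (a + t *\<^sub>R b) - poly P t = f (a + 0 *\<^sub>R b) - poly P 0" for t
      using DERIV_isconst_all[of "\<lambda>t. f (a + t *\<^sub>R b) - poly P t"] by blast
    have "f (a + t *\<^sub>R b) = poly (P + [:f a - poly P 0:]) t" for t
      using const[of t] by simp
    moreover have "degree (P + [:f a - poly P 0:]) \<le> Suc M"
      using P(2) Q(1) by (intro degree_add_le) auto
    ultimately show "\<exists>P. degree P \<le> Suc M \<and> (\<forall>t. f (a + t *\<^sub>R b) = poly P t)" by blast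
  qed
qed

text \<open>Left invariance at the origin gives X_k(a) as the derivative of y \<mapsto> a \<circ> y
  at 0 in direction e_k, so smoothness comes from the group law. Differentiating \<delta>_t(x
  \<circ> y) = \<delta>_t x \<circ> \<delta>_t y at y = 0 gives t X_k(\<delta>_t x) = \<delta>_t
  X_k(x).\<close>

lemma stratified_group_generators:
  fixes \<sigma> :: "'n::finite \<Rightarrow> nat"
  assumes G: "stratified_group r \<sigma> mul X" and k: "k \<in> first_layer \<sigma>"
  shows "smooth_on UNIV (\<lambda>x. X k x $ j)"
    and "homogeneous \<sigma> (real (\<sigma> j) - 1) (\<lambda>x. X k x $ j)"
proof -
  define m where "m = (\<lambda>(x, y). mul x y)"
  obtain e inv where grp: "group mul e inv" and m: "smooth_on UNIV m"
    using G unfolding stratified_group_def lie_group_law_def m_def by blast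
  interpret group mul e inv by (rule grp)
  have aut: "dilation \<sigma> t (mul x y) = mul (dilation \<sigma> t x) (dilation \<sigma> t y)" if "t > 0" for t x y
    using G that unfolding stratified_group_def by blast
  have \<sigma>: "\<sigma> j \<ge> 1" for j
    using G unfolding stratified_group_def by (metis atLeastAtMost_iff rangeI)
  \<comment> \<open>The image of the neutral element is idempotent, hence neutral itself; a fixed
    point of the dilation by 2 has only zero coordinates.\<close>
  have "dilation \<sigma> 2 e = mul (dilation \<sigma> 2 e) (dilation \<sigma> 2 e)"
    using aut[of 2 e e] by simp
  then have "dilation \<sigma> 2 e = e" by (metis assoc left_inverse left_neutral)
  then have "2 ^ \<sigma> j * e $ j = e $ j" for j
    by (metis dilation_def vec_lambda_beta)
  moreover have "(2::real) ^ \<sigma> j > 1" for j using \<sigma>[of j] by (intro one_less_power) auto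
  ultimately have "e $ j = 0" for j by (metis less_irrefl mult_cancel_right1)
  then have e: "e = 0" by (simp add: vec_eq_iff)
  define D where "D a = frechet_derivative m (at (a, 0)) (0, axis k 1)" for a
  have der: "(mul a has_derivative (\<lambda>v. frechet_derivative m (at (a, y)) (0, v))) (at y)" for a y
  proof -
    have "((\<lambda>y. (a, y)) has_derivative (\<lambda>v. (0, v))) (at y)"
      by (intro has_derivative_Pair has_derivative_const has_derivative_ident)
    from has_derivative_compose[OF this smooth_on_has_derivative[OF m]] show ?thesis
      by (simp add: m_def)
  qed
  have XD: "X k a = D a" for a
  proof -
    have "X k (mul a 0) = frechet_derivative (mul a) (at 0) (X k 0)" "X k 0 = axis k 1"
      using G k unfolding stratified_group_def left_invariant_def by blast+
    then show ?thesis
      using right_neutral[of a] fun_cong[OF frechet_derivative_at[OF der[of a 0]], of "axis k 1"] e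
      by (simp add: D_def)
  qed
  have "bounded_linear (\<lambda>a::real^'n. (a, 0::real^'n))"
    by (intro bounded_linear_Pair bounded_linear_ident bounded_linear_zero)
  from smooth_on_compose_affine[OF this bounded_linear_vec_nth[of j] smooth_on_directional_deriv[OF m, of "(0, axis k 1)"], of 0]
  show "smooth_on UNIV (\<lambda>x. X k x $ j)" by (simp add: XD D_def)
  show "homogeneous \<sigma> (real (\<sigma> j) - 1) (\<lambda>x. X k x $ j)"
    unfolding homogeneous_def
  proof (intro allI impI)
    fix t :: real and x assume t: "t > 0"
    have "((\<lambda>y. dilation \<sigma> t (mul x y)) has_derivative
        (\<lambda>v. frechet_derivative m (at (dilation \<sigma> t x, dilation \<sigma> t 0)) (0, dilation \<sigma> t v))) (at 0)"
      unfolding aut[OF t]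
      by (rule has_derivative_compose[OF bounded_linear.has_derivative[OF bounded_linear_dilation has_derivative_ident] der])
    moreover have "((\<lambda>y. dilation \<sigma> t (mul x y)) has_derivative
        (\<lambda>v. dilation \<sigma> t (frechet_derivative m (at (x, 0)) (0, v)))) (at 0)"
      by (rule bounded_linear.has_derivative[OF bounded_linear_dilation der])
    moreover have "dilation \<sigma> t 0 = 0" by (simp add: dilation_def vec_eq_iff)
    ultimately have "(\<lambda>v. frechet_derivative m (at (dilation \<sigma> t x, 0)) (0, dilation \<sigma> t v))
        = (\<lambda>v. dilation \<sigma> t (frechet_derivative m (at (x, 0)) (0, v)))"
      by (metis has_derivative_unique)
    from fun_cong[OF this, of "axis k 1"]
    have "frechet_derivative m (at (dilation \<sigma> t x, 0)) (0, dilation \<sigma> t (axis k 1)) = dilation \<sigma> t (D x)"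
      by (simp only: D_def)
    \<comment> \<open>First-layer axes are scaled by t itself; this is the -1 in the degree of the
      coefficients.\<close>
    moreover have "(0, dilation \<sigma> t (axis k 1)) = t *\<^sub>R (0, axis k 1)"
      using k by (simp add: dilation_axis first_layer_def)
    ultimately have "t *\<^sub>R D (dilation \<sigma> t x) = dilation \<sigma> t (D x)"
      using linear_cmul[OF has_derivative_linear[OF smooth_on_has_derivative[OF m]]]
      unfolding D_def by metis
    then have "t * X k (dilation \<sigma> t x) $ j = t ^ \<sigma> j * X k x $ j"
      unfolding XD by (metis dilation_def vec_lambda_beta vector_scaleR_component real_scaleR_def)
    then show "X k (dilation \<sigma> t x) $ j = t powr (real (\<sigma> j) - 1) * X k x $ j"
      using t by (simp add: powr_diff powr_realpow field_simps)
  qed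
qed

lemma stratified_group_layer_ge_1:
  "stratified_group r \<sigma> mul X \<Longrightarrow> \<sigma> j \<ge> 1"
  unfolding stratified_group_def by (metis atLeastAtMost_iff rangeI)

text \<open>The degree of homogeneity \<open>\<sigma> j - 1\<close> is below \<open>r\<close>, as no
  layer exceeds \<open>r\<close>.\<close>

lemma stratified_group_generator_poly_on_lines:
  assumes G: "stratified_group r \<sigma> mul X" and k: "k \<in> first_layer \<sigma>"
  shows "poly_on_lines r (\<lambda>x. X k x $ j)"
proof -
  have "\<sigma> j \<le> r" using G unfolding stratified_group_def by (metis atLeastAtMost_iff rangeI)
  then show ?thesis
    using homogeneous_poly_on_lines[OF stratified_group_layer_ge_1[OF G] stratified_group_generators[OF G k]]
    by simp
qed

text \<open>The partial derivative is homogeneous of degree \<open>-1\<close>; so the generators are divergence-free.\<close>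

lemma stratified_group_generator_partial_deriv_eq_0:
  assumes G: "stratified_group r \<sigma> mul X" and k: "k \<in> first_layer \<sigma>"
  shows "frechet_derivative (\<lambda>x. X k x $ j) (at x) (axis j 1) = 0"
proof -
  note smooth = stratified_group_generators(1)[OF G k, of j]
  have "homogeneous \<sigma> (- 1) (\<lambda>x. frechet_derivative (\<lambda>x. X k x $ j) (at x) (axis j 1))"
    using homogeneous_partial_deriv[OF stratified_group_generators(2)[OF G k] smooth_on_has_derivative[OF smooth], of j]
    by simp
  then show ?thesis
    by (rule homogeneous_neg_eq_0[OF _ _ stratified_group_layer_ge_1[OF G]
          smooth_on_continuous[OF smooth_on_directional_deriv[OF smooth]]]) simp
qed

subsection \<open>Integration by parts for the horizontal flux\<close>

text \<open>The setting of the integration by parts, freed from the group and the half-space.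
  \<open>X'_diag\<close> kills each diagonal partial derivative of the coefficients, so each field
  is divergence-free. The test function is only asked to be C^1, because |u|^p is in general not
  smooth.\<close>

locale horizontal_flux =
  fixes L :: "'n::finite set" and p :: real and M :: nat
    and X :: "'n \<Rightarrow> real^'n \<Rightarrow> real^'n" and X' :: "'n \<Rightarrow> 'n \<Rightarrow> real^'n \<Rightarrow> real^'n \<Rightarrow> real"
    and w :: "'n \<Rightarrow> real^'n \<Rightarrow> real" and w' :: "'n \<Rightarrow> real^'n \<Rightarrow> real^'n \<Rightarrow> real"
    and \<phi> :: "real^'n \<Rightarrow> real" and \<phi>' :: "real^'n \<Rightarrow> real^'n \<Rightarrow> real" and K :: "(real^'n) set"
  assumes p: "p > 1"
    and X': "\<And>k j x. k \<in> L \<Longrightarrow> ((\<lambda>x. X k x $ j) has_derivative X' k j x) (at x)"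
    and X'_cont: "\<And>k j v. k \<in> L \<Longrightarrow> continuous_on UNIV (\<lambda>x. X' k j x v)"
    and X'_diag: "\<And>k j x. k \<in> L \<Longrightarrow> X' k j x (axis j 1) = 0"
    and w': "\<And>k x. k \<in> L \<Longrightarrow> (w k has_derivative w' k x) (at x)"
    and w'_cont: "\<And>k v. k \<in> L \<Longrightarrow> continuous_on UNIV (\<lambda>x. w' k x v)"
    and w_poly: "\<And>k. k \<in> L \<Longrightarrow> poly_on_lines M (w k)"
    and \<phi>': "\<And>x. (\<phi> has_derivative \<phi>' x) (at x)"
    and \<phi>'_cont: "\<And>v. continuous_on UNIV (\<lambda>x. \<phi>' x v)"
    and K: "compact K"
    and \<phi>_supp: "\<And>x. x \<notin> K \<Longrightarrow> \<phi> x = 0"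
    and \<phi>'_supp: "\<And>x v. x \<notin> K \<Longrightarrow> \<phi>' x v = 0"
begin

definition Q :: "real^'n \<Rightarrow> real" where "Q x = (\<Sum>k\<in>L. (w k x)\<^sup>2)"

text \<open>
  \<open>V 0\<close> is the field $|w|^{p-2} w$; for positive \<open>\<epsilon>\<close> it is replaced by a regularization that stays
  differentiable at the zeros of $w$. The divergence of \<open>V \<epsilon>\<close> along the fields \<open>X k\<close> is \<open>G \<epsilon>\<close>.
\<close>

definition V :: "real \<Rightarrow> 'n \<Rightarrow> real^'n \<Rightarrow> real" where
  "V \<epsilon> k x = (Q x + \<epsilon>) powr ((p - 2) / 2) * w k x"

text \<open>The derivative of \<open>V \<epsilon> k\<close> by product and chain rule; the 2 from
  differentiating \<open>Q\<close> cancels the 1/2 in the exponent. It is a genuine derivative where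
  \<open>Q x + \<epsilon> > 0\<close>. At zeros of \<open>Q\<close> with
  \<open>\<epsilon> = 0\<close> its value is 0, by \<open>0 powr a = 0\<close>.\<close>

definition V' :: "real \<Rightarrow> 'n \<Rightarrow> real^'n \<Rightarrow> real^'n \<Rightarrow> real" where
  "V' \<epsilon> k x v = (Q x + \<epsilon>) powr ((p - 2) / 2) * w' k x v +
     w k x * ((p - 2) * (Q x + \<epsilon>) powr ((p - 4) / 2) * (\<Sum>j\<in>L. w j x * w' j x v))"

definition G :: "real \<Rightarrow> real^'n \<Rightarrow> real" where
  "G \<epsilon> x = (\<Sum>k\<in>L. V' \<epsilon> k x (X k x))"

lemma Q_nonneg: "Q x \<ge> 0" unfolding Q_def by (intro sum_nonneg) auto

lemma sq_le_Q: "k \<in> L \<Longrightarrow> (w k x)\<^sup>2 \<le> Q x"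
  unfolding Q_def by (intro member_le_sum) auto

lemma has_derivative_V:
  assumes k: "k \<in> L" and pos: "Q x + \<epsilon> > 0"
  shows "(V \<epsilon> k has_derivative V' \<epsilon> k x) (at x)"
proof -
  have "((\<lambda>x. Q x + \<epsilon>) has_derivative (\<lambda>v. 2 * (\<Sum>j\<in>L. w j x * w' j x v))) (at x)"
    unfolding Q_def
    by (rule has_derivative_eq_rhs, (rule derivative_intros w' | assumption)+)
      (auto simp: fun_eq_iff sum_distrib_left intro!: sum.cong)
  moreover have "((\<lambda>s. s powr ((p - 2) / 2)) has_derivative (*) ((p - 2) / 2 * (Q x + \<epsilon>) powr ((p - 4) / 2))) (at (Q x + \<epsilon>))"
  proof -
    have "((\<lambda>s. s powr ((p - 2) / 2)) has_real_derivative (p - 2) / 2 * (Q x + \<epsilon>) powr ((p - 2) / 2 - 1)) (at (Q x + \<epsilon>))"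
      using pos by (intro has_real_derivative_powr)
    moreover have "(p - 2) / 2 - 1 = (p - 4) / 2" by (simp add: field_simps)
    ultimately show ?thesis by (simp only: has_field_derivative_def)
  qed
  ultimately have "((\<lambda>x. (Q x + \<epsilon>) powr ((p - 2) / 2)) has_derivative
      (\<lambda>v. (p - 2) / 2 * (Q x + \<epsilon>) powr ((p - 4) / 2) * (2 * (\<Sum>j\<in>L. w j x * w' j x v)))) (at x)"
    by (rule has_derivative_compose)
  from has_derivative_mult[OF this w'[OF k, of x]] show ?thesis
    unfolding V_def[abs_def] V'_def[abs_def] by (rule has_derivative_eq_rhs) (auto simp: field_simps)
qed

section \<open>Continuity and measurability of the terms of the flux\<close>

lemma w_cont: "k \<in> L \<Longrightarrow> continuous_on UNIV (w k)"
  using w' has_derivative_continuous_on[of UNIV "w k" "w' k"] by auto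

lemma X_cont: "k \<in> L \<Longrightarrow> continuous_on UNIV (\<lambda>x. X k x $ j)"
  using X' has_derivative_continuous_on[of UNIV "\<lambda>x. X k x $ j" "X' k j"] by auto

lemma \<phi>_cont: "continuous_on UNIV \<phi>"
  using \<phi>' has_derivative_continuous_on[of UNIV \<phi> \<phi>'] by auto

lemma X_vec_cont: "k \<in> L \<Longrightarrow> continuous_on UNIV (X k)"
  using continuous_on_vec_lambda[of UNIV "\<lambda>j x. X k x $ j"] X_cont by simp

lemma w'_expand: "j \<in> L \<Longrightarrow> w' j x v = (\<Sum>m\<in>UNIV. v $ m * w' j x (axis m 1))"
  by (rule deriv_eq_sum_partial_derivs[OF has_derivative_linear[OF w']])

lemma \<phi>'_expand: "\<phi>' x v = (\<Sum>m\<in>UNIV. v $ m * \<phi>' x (axis m 1))"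
  by (rule deriv_eq_sum_partial_derivs[OF has_derivative_linear[OF \<phi>']])

lemma w'_X_cont: "j \<in> L \<Longrightarrow> k \<in> L \<Longrightarrow> continuous_on UNIV (\<lambda>x. w' j x (X k x))"
  by (subst w'_expand) (auto intro!: continuous_intros X_cont w'_cont)

lemma \<phi>'_X_cont: "k \<in> L \<Longrightarrow> continuous_on UNIV (\<lambda>x. \<phi>' x (X k x))"
  by (subst \<phi>'_expand) (auto intro!: continuous_intros X_cont \<phi>'_cont)

lemma Q_cont: "continuous_on UNIV Q"
  unfolding Q_def[abs_def] by (intro continuous_intros w_cont)

lemma measurable_V: "k \<in> L \<Longrightarrow> V \<epsilon> k \<in> borel_measurable borel"
proof -
  note [measurable] = borel_measurable_continuous_onI[OF Q_cont] borel_measurable_continuous_onI[OF w_cont]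
  show "k \<in> L \<Longrightarrow> V \<epsilon> k \<in> borel_measurable borel" unfolding V_def[abs_def] by measurable
qed

lemma measurable_G: "G \<epsilon> \<in> borel_measurable borel"
proof -
  note [measurable] = borel_measurable_continuous_onI[OF Q_cont] borel_measurable_continuous_onI[OF w_cont]
    borel_measurable_continuous_onI[OF w'_X_cont]
  show ?thesis unfolding G_def[abs_def] V'_def[abs_def] by measurable
qed

text \<open>For positive \<open>\<epsilon>\<close> everything is C^1 with compact support, so the
  j-th partial derivative of X_k^j V_k \<phi> integrates to 0. Summing over j and k leaves exactly
  the two stated terms, the derivatives of the coefficients being killed by
  \<open>X'_diag\<close>.\<close>

lemma integral_flux_regularized:
  assumes \<epsilon>: "\<epsilon> > 0"
  shows "(\<integral>x. (G \<epsilon> x * \<phi> x + (\<Sum>k\<in>L. V \<epsilon> k x * \<phi>' x (X k x))) \<partial>lborel) = 0"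
proof -
  have pos: "Q x + \<epsilon> > 0" for x using Q_nonneg[of x] \<epsilon> by simp
  have V_cont: "continuous_on UNIV (V \<epsilon> k)" if "k \<in> L" for k
    using has_derivative_continuous_on[of UNIV "V \<epsilon> k" "V' \<epsilon> k"] has_derivative_V[OF that pos] by auto
  have V'_cont: "continuous_on UNIV (\<lambda>x. V' \<epsilon> k x v)" if "k \<in> L" for k v
    unfolding V'_def using pos that
    by (intro continuous_intros Q_cont w_cont w'_cont) (auto simp: less_imp_neq[symmetric])
  define h' where "h' k j x v = X k x $ j * (V \<epsilon> k x * \<phi>' x v + V' \<epsilon> k x v * \<phi> x) + X' k j x v * (V \<epsilon> k x * \<phi> x)" for k j x v
  have h: "integrable lborel (\<lambda>x. h' k j x (axis j 1)) \<and> (\<integral>x. h' k j x (axis j 1) \<partial>lborel) = 0" if k: "k \<in> L" for k j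
  proof -
    have "((\<lambda>x. X k x $ j * (V \<epsilon> k x * \<phi> x)) has_derivative h' k j x) (at x)" for x
      unfolding h'_def[abs_def]
      by (intro has_derivative_mult X' has_derivative_V \<phi>' k pos)
    moreover have "continuous_on UNIV (\<lambda>x. h' k j x (axis j 1))"
      unfolding h'_def
      by (intro continuous_intros X_cont V_cont V'_cont \<phi>'_cont \<phi>_cont X'_cont k)
    ultimately show ?thesis
      using integral_directional_deriv_eq_0[of "\<lambda>x. X k x $ j * (V \<epsilon> k x * \<phi> x)" "h' k j" "axis j 1" K] K \<phi>_supp
      by auto
  qed
  have V'_expand: "V' \<epsilon> k x v = (\<Sum>m\<in>UNIV. v $ m * V' \<epsilon> k x (axis m 1))" if "k \<in> L" for k x v
    by (rule deriv_eq_sum_partial_derivs[OF has_derivative_linear[OF has_derivative_V[OF that pos]]])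
  have "G \<epsilon> x * \<phi> x + (\<Sum>k\<in>L. V \<epsilon> k x * \<phi>' x (X k x)) = (\<Sum>k\<in>L. \<Sum>j\<in>UNIV. h' k j x (axis j 1))" for x
  proof -
    have "G \<epsilon> x * \<phi> x + (\<Sum>k\<in>L. V \<epsilon> k x * \<phi>' x (X k x))
        = (\<Sum>k\<in>L. V' \<epsilon> k x (X k x) * \<phi> x + V \<epsilon> k x * \<phi>' x (X k x))"
      unfolding G_def by (simp add: sum_distrib_right sum.distrib)
    also have "\<dots> = (\<Sum>k\<in>L. \<Sum>j\<in>UNIV. h' k j x (axis j 1))"
    proof (rule sum.cong[OF refl])
      fix k assume k: "k \<in> L"
      show "V' \<epsilon> k x (X k x) * \<phi> x + V \<epsilon> k x * \<phi>' x (X k x) = (\<Sum>j\<in>UNIV. h' k j x (axis j 1))"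
        unfolding V'_expand[OF k, of x "X k x"] \<phi>'_expand[of x "X k x"] sum_distrib_left sum_distrib_right sum.distrib[symmetric]
        by (rule sum.cong) (auto simp: h'_def X'_diag[OF k] algebra_simps)
    qed
    finally show ?thesis .
  qed
  then have "(\<integral>x. (G \<epsilon> x * \<phi> x + (\<Sum>k\<in>L. V \<epsilon> k x * \<phi>' x (X k x))) \<partial>lborel)
      = (\<integral>x. (\<Sum>k\<in>L. \<Sum>j\<in>UNIV. h' k j x (axis j 1)) \<partial>lborel)" by simp
  also have "\<dots> = (\<Sum>k\<in>L. \<integral>x. (\<Sum>j\<in>UNIV. h' k j x (axis j 1)) \<partial>lborel)"
    using h by (intro Bochner_Integration.integral_sum Bochner_Integration.integrable_sum) auto
  also have "\<dots> = (\<Sum>k\<in>L. \<Sum>j\<in>UNIV. \<integral>x. h' k j x (axis j 1) \<partial>lborel)"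
    using h by (intro sum.cong refl Bochner_Integration.integral_sum) auto
  also have "\<dots> = 0" using h by simp
  finally show ?thesis .
qed

text \<open>A bound free of \<open>\<epsilon>\<close> in both regimes: for p \<ge> 2 the power
  increases and \<open>\<epsilon> \<le> 1\<close> gives the second summand; for p < 2 it decreases
  and \<open>Q x + \<epsilon>\<close> is at least the square of \<open>w j x\<close>, which gives
  the first.\<close>

lemma powr_Q_le:
  assumes "j \<in> L" "w j x \<noteq> 0" "0 < \<epsilon>" "\<epsilon> \<le> 1"
  shows "(Q x + \<epsilon>) powr ((p - 2) / 2) \<le> \<bar>w j x\<bar> powr (p - 2) + (Q x + 1) powr ((p - 2) / 2)"
proof (cases "p \<ge> 2")
  case True
  then have "(Q x + \<epsilon>) powr ((p - 2) / 2) \<le> (Q x + 1) powr ((p - 2) / 2)"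
    using assms Q_nonneg[of x] by (intro powr_mono2) auto
  then show ?thesis by (simp add: add_increasing)
next
  case False
  have "(Q x + \<epsilon>) powr ((p - 2) / 2) \<le> ((w j x)\<^sup>2) powr ((p - 2) / 2)"
    using assms False sq_le_Q[of j x] by (intro powr_mono2') auto
  also have "((w j x)\<^sup>2) powr ((p - 2) / 2) = \<bar>w j x\<bar> powr (p - 2)"
  proof -
    have "(w j x)\<^sup>2 = \<bar>w j x\<bar> powr 2" using assms by (simp add: powr_numeral)
    moreover have "2 * ((p - 2) / 2) = p - 2" by simp
    ultimately show ?thesis by (simp only: powr_powr)
  qed
  finally show ?thesis by (simp add: add_increasing2)
qed

text \<open>The exponent (p-4)/2 is one worse than (p-2)/2, but the factors w_k w_j are at most
  \<open>Q x + \<epsilon>\<close> and make up for it. Of the constant, 1 belongs to the first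
  summand of \<open>V'\<close> and |p - 2| to the second.\<close>

lemma abs_V'_le:
  assumes k: "k \<in> L" and pos: "Q x + \<epsilon> > 0" and \<epsilon>: "\<epsilon> \<ge> 0"
  shows "\<bar>V' \<epsilon> k x v\<bar> \<le> (1 + \<bar>p - 2\<bar>) * (\<Sum>j\<in>L. (Q x + \<epsilon>) powr ((p - 2) / 2) * \<bar>w' j x v\<bar>)"
proof -
  let ?A = "(Q x + \<epsilon>) powr ((p - 2) / 2)" and ?B = "(Q x + \<epsilon>) powr ((p - 4) / 2)"
  have AB: "?A = ?B * (Q x + \<epsilon>)"
  proof -
    have "?B * (Q x + \<epsilon>) = ?B * (Q x + \<epsilon>) powr 1" using pos by simp
    also have "\<dots> = (Q x + \<epsilon>) powr ((p - 4) / 2 + 1)" by (simp only: powr_add)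
    also have "(p - 4) / 2 + 1 = (p - 2) / 2" by (simp add: field_simps)
    finally show ?thesis by simp
  qed
  have prod: "\<bar>w k x\<bar> * \<bar>w j x\<bar> \<le> Q x + \<epsilon>" if "j \<in> L" for j
  proof -
    have "\<bar>w k x\<bar> \<le> sqrt (Q x)" "\<bar>w j x\<bar> \<le> sqrt (Q x)"
      using sq_le_Q[OF k, of x] sq_le_Q[OF that, of x] by (auto intro: real_le_rsqrt)
    then have "\<bar>w k x\<bar> * \<bar>w j x\<bar> \<le> sqrt (Q x) * sqrt (Q x)"
      using Q_nonneg[of x] by (intro mult_mono) auto
    then show ?thesis using Q_nonneg[of x] \<epsilon> by simp
  qed
  have "\<bar>w k x * (?B * (\<Sum>j\<in>L. w j x * w' j x v))\<bar> \<le> (\<Sum>j\<in>L. ?A * \<bar>w' j x v\<bar>)"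
  proof -
    have "\<bar>w k x * (?B * (\<Sum>j\<in>L. w j x * w' j x v))\<bar> = \<bar>\<Sum>j\<in>L. w k x * (?B * (w j x * w' j x v))\<bar>"
      by (simp add: sum_distrib_left)
    also have "\<dots> \<le> (\<Sum>j\<in>L. \<bar>w k x * (?B * (w j x * w' j x v))\<bar>)" by (rule sum_abs)
    also have "\<dots> \<le> (\<Sum>j\<in>L. ?A * \<bar>w' j x v\<bar>)"
    proof (rule sum_mono)
      fix j assume "j \<in> L"
      have "\<bar>w k x * (?B * (w j x * w' j x v))\<bar> = ?B * (\<bar>w k x\<bar> * \<bar>w j x\<bar>) * \<bar>w' j x v\<bar>"
        by (simp add: abs_mult)
      also have "\<dots> \<le> ?B * (Q x + \<epsilon>) * \<bar>w' j x v\<bar>"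
        by (intro mult_right_mono mult_left_mono prod \<open>j \<in> L\<close>) auto
      finally show "\<bar>w k x * (?B * (w j x * w' j x v))\<bar> \<le> ?A * \<bar>w' j x v\<bar>" using AB by simp
    qed
    finally show ?thesis .
  qed
  then have "\<bar>p - 2\<bar> * \<bar>w k x * (?B * (\<Sum>j\<in>L. w j x * w' j x v))\<bar> \<le> \<bar>p - 2\<bar> * (\<Sum>j\<in>L. ?A * \<bar>w' j x v\<bar>)"
    by (rule mult_left_mono) simp
  moreover have "?A * \<bar>w' k x v\<bar> \<le> (\<Sum>j\<in>L. ?A * \<bar>w' j x v\<bar>)"
    using k by (intro member_le_sum) auto
  moreover have "\<bar>V' \<epsilon> k x v\<bar> \<le> ?A * \<bar>w' k x v\<bar> + \<bar>p - 2\<bar> * \<bar>w k x * (?B * (\<Sum>j\<in>L. w j x * w' j x v))\<bar>"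
    unfolding V'_def by (rule order.trans[OF abs_triangle_ineq]) (simp add: abs_mult)
  ultimately show ?thesis by (simp add: algebra_simps)
qed

text \<open>The factor w_k contributes half a power, so the total exponent (p-1)/2 is positive: the
  field itself is never singular, only its derivative is.\<close>

lemma abs_V_le:
  assumes k: "k \<in> L" and \<epsilon>: "0 \<le> \<epsilon>" "\<epsilon> \<le> 1"
  shows "\<bar>V \<epsilon> k x\<bar> \<le> (Q x + 1) powr ((p - 1) / 2)"
proof (cases "Q x + \<epsilon> = 0")
  case True
  then show ?thesis by (simp add: V_def)
next
  case False
  then have pos: "Q x + \<epsilon> > 0" using Q_nonneg[of x] \<epsilon> by simp
  have "\<bar>w k x\<bar> \<le> sqrt (Q x + \<epsilon>)"
    using sq_le_Q[OF k, of x] \<epsilon> by (auto intro: real_le_rsqrt)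
  then have "\<bar>w k x\<bar> \<le> (Q x + \<epsilon>) powr (1 / 2)" using pos by (simp add: powr_half_sqrt)
  then have "\<bar>V \<epsilon> k x\<bar> \<le> (Q x + \<epsilon>) powr ((p - 2) / 2) * (Q x + \<epsilon>) powr (1 / 2)"
    unfolding V_def by (simp add: abs_mult mult_left_mono)
  also have "\<dots> = (Q x + \<epsilon>) powr ((p - 1) / 2)"
    by (simp add: powr_add[symmetric] add_divide_distrib[symmetric])
  also have "\<dots> \<le> (Q x + 1) powr ((p - 1) / 2)"
    using pos p \<epsilon> by (intro powr_mono2) auto
  finally show ?thesis .
qed

text \<open>The alternative is needed for components that vanish identically; they have zero
  derivative and drop out of the estimates.\<close>

lemma AE_w_nonzero:
  "AE x in lborel. \<forall>j\<in>L. w j x \<noteq> 0 \<or> (\<forall>y. w j y = 0)"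
proof (rule AE_ball_countable[THEN iffD2])
  show "\<forall>j\<in>L. AE x in lborel. w j x \<noteq> 0 \<or> (\<forall>y. w j y = 0)"
  proof
    fix j assume j: "j \<in> L"
    show "AE x in lborel. w j x \<noteq> 0 \<or> (\<forall>y. w j y = 0)"
    proof (cases "\<forall>y. w j y = 0")
      case False
      then obtain a where "w j a \<noteq> 0" by blast
      then have "negligible {x. w j x = 0}"
        using negligible_zeros_poly_on_lines[OF w_poly[OF j] w_cont[OF j]] by blast
      moreover have "{x. w j x = 0} \<in> sets lborel"
        using continuous_closed_preimage_constant[OF w_cont[OF j], of 0] by (simp add: vimage_def)
      ultimately have "{x. w j x = 0} \<in> null_sets lborel"
        by (simp add: negligible_iff_null_sets null_sets_completion_iff)
      then show ?thesis by (rule AE_I') auto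
    qed simp
  qed
qed (auto intro: countable_finite)

text \<open>The regularized identity passes to the limit by dominated convergence. Nontriviality of
  one component makes \<open>Q\<close> positive almost everywhere, which gives pointwise
  convergence.\<close>

theorem integral_flux:
  assumes nontrivial: "k0 \<in> L" "w k0 a \<noteq> 0"
  shows "integrable lborel (\<lambda>x. G 0 x * \<phi> x)"
    and "integrable lborel (\<lambda>x. \<Sum>k\<in>L. V 0 k x * \<phi>' x (X k x))"
    and "(\<integral>x. G 0 x * \<phi> x \<partial>lborel) = - (\<integral>x. (\<Sum>k\<in>L. V 0 k x * \<phi>' x (X k x)) \<partial>lborel)"
proof -
  \<comment> \<open>The limit is taken for the sum of both terms. Integrability of the singular term
    follows afterwards by subtracting the harmless one.\<close>
  define s where "s \<epsilon> x = G \<epsilon> x * \<phi> x + (\<Sum>k\<in>L. V \<epsilon> k x * \<phi>' x (X k x))" for \<epsilon> x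
  define e where "e n = inverse (real (Suc n))" for n
  have e: "0 < e n" "e n \<le> 1" for n by (auto simp: e_def field_simps)
  define H where "H x = \<bar>\<phi> x\<bar> * (1 + \<bar>p - 2\<bar>) * (\<Sum>k\<in>L. norm (X k x))" for x
  have "continuous_on UNIV H" unfolding H_def by (intro continuous_intros \<phi>_cont X_vec_cont)
  then have "compact (H ` K)" by (intro compact_continuous_image K) (auto intro: continuous_on_subset)
  then obtain B where B: "\<And>x. x \<in> K \<Longrightarrow> \<bar>H x\<bar> \<le> B"
    by (metis bounded_real compact_imp_bounded imageI)
  define P where "P j m x = \<bar>w j x\<bar> powr (p - 2) * \<bar>w' j x (axis m 1)\<bar>" for j m x
  define R where "R x = \<bar>\<phi> x\<bar> * (1 + \<bar>p - 2\<bar>) * (\<Sum>k\<in>L. \<Sum>j\<in>L. (Q x + 1) powr ((p - 2) / 2) * \<bar>w' j x (X k x)\<bar>)" for x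
  define R2 where "R2 x = (\<Sum>k\<in>L. (Q x + 1) powr ((p - 1) / 2) * \<bar>\<phi>' x (X k x)\<bar>)" for x
  have Q1: "Q x + 1 \<noteq> 0" for x using Q_nonneg[of x] by simp
  have "continuous_on UNIV R" "continuous_on UNIV R2"
    unfolding R_def R2_def using Q1
    by (intro continuous_intros \<phi>_cont Q_cont w'_X_cont \<phi>'_X_cont; blast)+
  then have intR: "integrable lborel (\<lambda>x. indicator K x * R x)" and intR2: "integrable lborel (\<lambda>x. indicator K x * R2 x)"
    using borel_integrable_compact[OF K, of R] borel_integrable_compact[OF K, of R2]
    by (auto intro: continuous_on_subset)
  obtain r where r: "K \<subseteq> cball 0 r"
    using compact_imp_bounded[OF K] bounded_subset_ballD ball_subset_cball by (metis order.trans)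
  have "K \<in> sets borel" using K by (simp add: compact_imp_closed)
  have intP: "integrable lborel (\<lambda>x. indicator K x * P j m x)" if j: "j \<in> L" for j m
  proof (rule Bochner_Integration.integrable_bound)
    have "p - 1 - 1 = p - 2" by simp
    then show "integrable lborel (\<lambda>x. indicator (cball 0 r) x * P j m x)"
      using integrable_poly_on_lines_powr_deriv[of "p - 1" M "w j" "w' j" "axis m 1" r] p w_poly[OF j] w'[OF j] w'_cont[OF j]
      unfolding P_def by simp
    note [measurable] = borel_measurable_continuous_onI[OF w_cont[OF j]] borel_measurable_continuous_onI[OF w'_cont[OF j]] \<open>K \<in> sets borel\<close>
    show "(\<lambda>x. indicator K x * P j m x) \<in> borel_measurable lborel" unfolding P_def by measurable
    show "AE x in lborel. norm (indicator K x * P j m x) \<le> norm (indicator (cball 0 r) x * P j m x)"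
      using r by (intro AE_I2) (auto simp: indicator_def)
  qed
  \<comment> \<open>The majorant, independent of \<open>\<epsilon>\<close>: the singular products
    |w_j|^(p-2) |\<partial>_m w_j|, whose coefficients are bounded by \<open>B\<close> on
    \<open>K\<close>, then \<open>R\<close> for the regime p \<ge> 2 and \<open>R2\<close> for the
    term with the derivative of \<open>\<phi>\<close>.\<close>
  define D where "D x = B * (\<Sum>j\<in>L. \<Sum>m\<in>UNIV. indicator K x * P j m x) + (indicator K x * R x + indicator K x * R2 x)" for x
  have intD: "integrable lborel D"
    unfolding D_def[abs_def] by (intro Bochner_Integration.integrable_add integrable_mult_right Bochner_Integration.integrable_sum intP intR intR2)
  have ms: "s \<epsilon> \<in> borel_measurable lborel" for \<epsilon>
  proof -
    note [measurable] = measurable_G measurable_V borel_measurable_continuous_onI[OF \<phi>_cont] borel_measurable_continuous_onI[OF \<phi>'_X_cont]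
    show ?thesis unfolding s_def[abs_def] by measurable
  qed
  have bound: "norm (s \<epsilon> x) \<le> D x"
    if ae: "\<forall>j\<in>L. w j x \<noteq> 0 \<or> (\<forall>y. w j y = 0)" and \<epsilon>: "0 < \<epsilon>" "\<epsilon> \<le> 1" for x \<epsilon>
  proof (cases "x \<in> K")
    case False
    then show ?thesis by (simp add: s_def D_def \<phi>_supp \<phi>'_supp)
  next
    case True
    have pos: "Q x + \<epsilon> > 0" using Q_nonneg[of x] \<epsilon> by simp
    let ?A = "(Q x + \<epsilon>) powr ((p - 2) / 2)" and ?C = "(Q x + 1) powr ((p - 2) / 2)"
    \<comment> \<open>Here the common weight is traded for the weight of the same component whose
      derivative it multiplies; only this pairing is known to be integrable.\<close>
    have bnd: "?A * \<bar>w' j x (X k x)\<bar> \<le> norm (X k x) * (\<Sum>m\<in>UNIV. P j m x) + ?C * \<bar>w' j x (X k x)\<bar>"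
      if jk: "j \<in> L" "k \<in> L" for j k
    proof (cases "\<forall>y. w j y = 0")
      case True
      then have "w j = (\<lambda>y. 0)" by auto
      then have "w' j x = (\<lambda>v. 0)"
        using has_derivative_unique[OF w'[OF jk(1), of x]] by auto
      then show ?thesis by (simp add: P_def)
    next
      case False
      then have "w j x \<noteq> 0" using ae jk by blast
      then have "?A * \<bar>w' j x (X k x)\<bar> \<le> (\<bar>w j x\<bar> powr (p - 2) + ?C) * \<bar>w' j x (X k x)\<bar>"
        using powr_Q_le[OF jk(1)] \<epsilon> by (intro mult_right_mono) auto
      moreover have "\<bar>w j x\<bar> powr (p - 2) * \<bar>w' j x (X k x)\<bar> \<le> norm (X k x) * (\<Sum>m\<in>UNIV. P j m x)"
      proof -
        have "\<bar>w' j x (X k x)\<bar> \<le> (\<Sum>m\<in>UNIV. \<bar>X k x $ m * w' j x (axis m 1)\<bar>)"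
          unfolding w'_expand[OF jk(1), of x "X k x"] by (rule sum_abs)
        also have "\<dots> \<le> (\<Sum>m\<in>UNIV. norm (X k x) * \<bar>w' j x (axis m 1)\<bar>)"
          unfolding abs_mult by (intro sum_mono mult_right_mono component_le_norm_cart) auto
        finally have "\<bar>w j x\<bar> powr (p - 2) * \<bar>w' j x (X k x)\<bar> \<le> \<bar>w j x\<bar> powr (p - 2) * (\<Sum>m\<in>UNIV. norm (X k x) * \<bar>w' j x (axis m 1)\<bar>)"
          by (rule mult_left_mono) simp
        also have "\<dots> = norm (X k x) * (\<Sum>m\<in>UNIV. P j m x)"
          by (simp add: P_def sum_distrib_left mult_ac)
        finally show ?thesis .
      qed
      ultimately show ?thesis by (simp add: algebra_simps)
    qed
    have "\<bar>G \<epsilon> x\<bar> \<le> (\<Sum>k\<in>L. \<bar>V' \<epsilon> k x (X k x)\<bar>)" unfolding G_def by (rule sum_abs)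
    also have "\<dots> \<le> (\<Sum>k\<in>L. (1 + \<bar>p - 2\<bar>) * (\<Sum>j\<in>L. ?A * \<bar>w' j x (X k x)\<bar>))"
      using \<epsilon> pos by (intro sum_mono abs_V'_le) auto
    also have "\<dots> \<le> (\<Sum>k\<in>L. (1 + \<bar>p - 2\<bar>) * (\<Sum>j\<in>L. norm (X k x) * (\<Sum>m\<in>UNIV. P j m x) + ?C * \<bar>w' j x (X k x)\<bar>))"
      by (intro sum_mono mult_left_mono bnd) auto
    also have "\<dots> = (1 + \<bar>p - 2\<bar>) * ((\<Sum>k\<in>L. norm (X k x)) * (\<Sum>j\<in>L. \<Sum>m\<in>UNIV. P j m x) + (\<Sum>k\<in>L. \<Sum>j\<in>L. ?C * \<bar>w' j x (X k x)\<bar>))"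
      by (simp add: sum.distrib sum_distrib_left[symmetric] sum_distrib_right[symmetric])
    finally have "\<bar>G \<epsilon> x\<bar> * \<bar>\<phi> x\<bar> \<le> (1 + \<bar>p - 2\<bar>) * ((\<Sum>k\<in>L. norm (X k x)) * (\<Sum>j\<in>L. \<Sum>m\<in>UNIV. P j m x) + (\<Sum>k\<in>L. \<Sum>j\<in>L. ?C * \<bar>w' j x (X k x)\<bar>)) * \<bar>\<phi> x\<bar>"
      by (rule mult_right_mono) simp
    also have "\<dots> = H x * (\<Sum>j\<in>L. \<Sum>m\<in>UNIV. P j m x) + R x"
      unfolding H_def R_def by (simp add: algebra_simps)
    also have "\<dots> \<le> B * (\<Sum>j\<in>L. \<Sum>m\<in>UNIV. P j m x) + R x"
      using B[OF True] by (intro add_right_mono mult_right_mono sum_nonneg) (auto simp: P_def)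
    finally have "\<bar>G \<epsilon> x * \<phi> x\<bar> \<le> B * (\<Sum>j\<in>L. \<Sum>m\<in>UNIV. P j m x) + R x" by (simp add: abs_mult)
    moreover have "\<bar>\<Sum>k\<in>L. V \<epsilon> k x * \<phi>' x (X k x)\<bar> \<le> R2 x"
      unfolding R2_def using \<epsilon>
      by (intro order.trans[OF sum_abs] sum_mono) (auto simp: abs_mult intro!: mult_right_mono abs_V_le)
    ultimately show ?thesis using True by (simp add: s_def D_def)
  qed
  have lim: "(\<lambda>n. s (e n) x) \<longlonglongrightarrow> s 0 x" if "Q x > 0" for x
  proof -
    have "e \<longlonglongrightarrow> 0" unfolding e_def[abs_def] by (rule LIMSEQ_inverse_real_of_nat)
    then show ?thesis
      unfolding s_def G_def V'_def V_def using that
      by (intro tendsto_intros) auto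
  qed
  note ae = AE_w_nonzero
  have ae_lim: "AE x in lborel. (\<lambda>n. s (e n) x) \<longlonglongrightarrow> s 0 x"
    using ae
  proof eventually_elim
    case (elim x)
    then have "w k0 x \<noteq> 0" using nontrivial by blast
    then have "Q x > 0" using sq_le_Q[OF nontrivial(1), of x] by (meson less_le_trans zero_less_power2)
    then show ?case by (rule lim)
  qed
  have ae_bound: "AE x in lborel. norm (s (e n) x) \<le> D x" for n
    using ae by eventually_elim (use bound e in auto)
  note dct = ms ms intD ae_lim ae_bound
  have ints: "integrable lborel (s 0)"
    by (rule integrable_dominated_convergence[OF dct])
  have s0: "(\<integral>x. s 0 x \<partial>lborel) = 0"
  proof -
    have "(\<lambda>n. \<integral>x. s (e n) x \<partial>lborel) \<longlonglongrightarrow> (\<integral>x. s 0 x \<partial>lborel)"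
      by (rule integral_dominated_convergence[OF dct])
    moreover have "(\<integral>x. s (e n) x \<partial>lborel) = 0" for n
      unfolding s_def by (rule integral_flux_regularized[OF e(1)])
    ultimately show ?thesis by (simp add: LIMSEQ_const_iff)
  qed
  show int2: "integrable lborel (\<lambda>x. \<Sum>k\<in>L. V 0 k x * \<phi>' x (X k x))"
  proof (rule Bochner_Integration.integrable_bound[OF intR2])
    note [measurable] = measurable_V borel_measurable_continuous_onI[OF \<phi>'_X_cont]
    show "(\<lambda>x. \<Sum>k\<in>L. V 0 k x * \<phi>' x (X k x)) \<in> borel_measurable lborel" by measurable
    have "norm (\<Sum>k\<in>L. V 0 k x * \<phi>' x (X k x)) \<le> norm (indicator K x * R2 x)" for x
    proof (cases "x \<in> K")
      case True
      have "\<bar>\<Sum>k\<in>L. V 0 k x * \<phi>' x (X k x)\<bar> \<le> R2 x"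
        unfolding R2_def
        by (intro order.trans[OF sum_abs] sum_mono) (auto simp: abs_mult intro!: mult_right_mono abs_V_le)
      then show ?thesis using True by simp
    qed (simp add: \<phi>'_supp)
    then show "AE x in lborel. norm (\<Sum>k\<in>L. V 0 k x * \<phi>' x (X k x)) \<le> norm (indicator K x * R2 x)" by simp
  qed
  have "(\<lambda>x. G 0 x * \<phi> x) = (\<lambda>x. s 0 x - (\<Sum>k\<in>L. V 0 k x * \<phi>' x (X k x)))"
    by (simp add: s_def)
  then show "integrable lborel (\<lambda>x. G 0 x * \<phi> x)"
    and "(\<integral>x. G 0 x * \<phi> x \<partial>lborel) = - (\<integral>x. (\<Sum>k\<in>L. V 0 k x * \<phi>' x (X k x)) \<partial>lborel)"
    using ints int2 s0 by auto
qed

end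

subsection \<open>The weighted inequality\<close>

lemma open_half_space: "open (half_space \<nu> d)"
  unfolding half_space_def using open_halfspace_gt[of d \<nu>] by (simp add: inner_commute[of _ \<nu>])

lemma has_derivative_zero_off_support:
  assumes f': "(f has_derivative f') (at x)" and K: "closed K" "x \<notin> K" and supp: "\<And>x. x \<notin> K \<Longrightarrow> f x = 0"
  shows "f' v = 0"
proof -
  have "(f has_derivative (\<lambda>v. 0)) (at x)"
    by (rule has_derivative_transform_within_open[of "\<lambda>x. 0" _ _ _ "- K"]) (use K supp in auto)
  then show ?thesis using has_derivative_unique[OF f'] by simp
qed

text \<open>The half-space and the complement of \<open>K\<close> are open and cover the space. On
  the first the distance is positive and |u|^p is C^1 since p > 1; on the second \<open>u\<close>
  vanishes, so the behaviour of the power of the distance at the boundary and beyond is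
  irrelevant.\<close>

lemma powr_quotient_derivative:
  fixes u :: "real^'n::finite \<Rightarrow> real"
  assumes p: "p > 1" and u': "\<And>x. (u has_derivative u' x) (at x)"
    and u'_cont: "\<And>v. continuous_on UNIV (\<lambda>x. u' x v)"
    and K: "closed K" "K \<subseteq> half_space \<nu> d" and supp: "\<And>x. x \<notin> K \<Longrightarrow> u x = 0"
  defines "\<phi> \<equiv> \<lambda>x. \<bar>u x\<bar> powr p * boundary_dist \<nu> d x powr (1 - p)"
    and "\<phi>' \<equiv> \<lambda>x v. p * signed_powr (p - 1) (u x) * u' x v * boundary_dist \<nu> d x powr (1 - p)
      + \<bar>u x\<bar> powr p * ((1 - p) * boundary_dist \<nu> d x powr (- p) * (v \<bullet> \<nu>))"
  shows "(\<phi> has_derivative \<phi>' x) (at x)" and "continuous_on UNIV (\<lambda>x. \<phi>' x v)"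
    and "x \<notin> K \<Longrightarrow> \<phi>' x v = 0"
proof -
  have u_cont: "continuous_on UNIV u"
    using u' has_derivative_continuous_on[of UNIV u u'] by auto
  show zero: "\<phi>' x v = 0" if "x \<notin> K" for x v
    using supp[OF that] by (simp add: \<phi>'_def signed_powr_def)
  show "(\<phi> has_derivative \<phi>' x) (at x)"
  proof (cases "x \<in> half_space \<nu> d")
    case True
    then have pos: "boundary_dist \<nu> d x > 0" by (simp add: half_space_def boundary_dist_def)
    have 1: "((\<lambda>x. \<bar>u x\<bar> powr p) has_derivative (\<lambda>v. p * signed_powr (p - 1) (u x) * u' x v)) (at x)"
      using has_derivative_compose[OF u' has_field_derivative_imp_has_derivative[OF has_real_derivative_abs_powr[OF p]]] .
    have "((\<lambda>s. s powr (1 - p)) has_real_derivative (1 - p) * boundary_dist \<nu> d x powr (- p)) (at (boundary_dist \<nu> d x))"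
      using pos has_real_derivative_powr[of "boundary_dist \<nu> d x" "1 - p"] by simp
    moreover have "(boundary_dist \<nu> d has_derivative (\<lambda>v. v \<bullet> \<nu>)) (at x)"
      unfolding boundary_dist_def[abs_def] by (auto intro!: derivative_eq_intros)
    ultimately have 2: "((\<lambda>x. boundary_dist \<nu> d x powr (1 - p)) has_derivative
        (\<lambda>v. (1 - p) * boundary_dist \<nu> d x powr (- p) * (v \<bullet> \<nu>))) (at x)"
      using has_derivative_compose has_field_derivative_imp_has_derivative by blast
    show ?thesis unfolding \<phi>_def \<phi>'_def
      by (rule has_derivative_eq_rhs[OF has_derivative_mult[OF 1 2]]) (auto simp: algebra_simps)
  next
    case False
    then have x: "x \<notin> K" using K by blast
    have "(\<phi> has_derivative (\<lambda>v. 0)) (at x)"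
      by (rule has_derivative_transform_within_open[of "\<lambda>x. 0" _ _ _ "- K"]) (use K x supp in \<open>auto simp: \<phi>_def\<close>)
    moreover have "\<phi>' x = (\<lambda>v. 0)" using zero[OF x] by auto
    ultimately show ?thesis by simp
  qed
  have "continuous_on (half_space \<nu> d) (\<lambda>x. \<phi>' x v)"
    unfolding \<phi>'_def boundary_dist_def using p
    by (intro continuous_intros continuous_on_compose2[OF continuous_on_signed_powr[of "p - 1" UNIV]]
        continuous_on_powr'[of _ "\<lambda>x. \<bar>u x\<bar>"] continuous_on_subset[OF u_cont] continuous_on_subset[OF u'_cont])
      (auto simp: half_space_def)
  moreover have "continuous_on (- K) (\<lambda>x. \<phi>' x v)"
    using continuous_on_cong[of "- K" "- K" "\<lambda>x. \<phi>' x v" "\<lambda>x. 0"] zero by simp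
  ultimately have "continuous_on (half_space \<nu> d \<union> - K) (\<lambda>x. \<phi>' x v)"
    using K(1) open_half_space by (intro continuous_on_open_Un) auto
  moreover have "half_space \<nu> d \<union> - K = UNIV" using K by blast
  ultimately show "continuous_on UNIV (\<lambda>x. \<phi>' x v)" by simp
qed

text \<open>To be read with N = |\<nabla>u|, W = |w|, t = u, b = |u|^(p-2) u and S the inner product
  of w and \<nabla>u. The part with W^2 cancels the \<open>\<beta>\<close> in the constant; the part
  with S is at most p N Y, to which Young's inequality applies.\<close>

lemma hardy_pointwise:
  fixes N W \<delta> S t b \<beta> p :: real
  assumes p: "p > 1" and N: "N \<ge> 0" and W: "W \<ge> 0" and \<delta>: "\<delta> > 0" and S: "\<bar>S\<bar> \<le> W * N"
    and b: "\<bar>b\<bar> = \<bar>t\<bar> powr (p - 1)"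
  shows "- (p - 1) * (\<bar>\<beta>\<bar> powr (p / (p - 1)) + \<beta>) * (W powr p / \<delta> powr p * \<bar>t\<bar> powr p)
    - \<beta> * ((W\<^sup>2) powr ((p - 2) / 2) * (p * b * \<delta> powr (1 - p) * S + (1 - p) * \<bar>t\<bar> powr p * \<delta> powr (- p) * W\<^sup>2))
    \<le> N powr p"
proof -
  \<comment> \<open>Chosen so that its power with the conjugate exponent p/(p-1) is
    |\<beta>|^(p/(p-1)) times \<open>Z\<close>, the weighted integrand.\<close>
  define Y where "Y = \<bar>\<beta>\<bar> * (W * \<bar>t\<bar> / \<delta>) powr (p - 1)"
  define Z where "Z = W powr p / \<delta> powr p * \<bar>t\<bar> powr p"
  have WW: "(W\<^sup>2) powr ((p - 2) / 2) = W powr (p - 2)"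
  proof (cases "W = 0")
    case False
    then have "W\<^sup>2 = W powr 2" using W by (simp add: powr_numeral)
    moreover have "2 * ((p - 2) / 2) = p - 2" by simp
    ultimately show ?thesis by (simp only: powr_powr)
  qed simp
  have W2: "W powr (p - 2) * W\<^sup>2 = W powr p"
  proof (cases "W = 0")
    case False
    then have "W\<^sup>2 = W powr 2" using W by (simp add: powr_numeral)
    then show ?thesis by (simp only: powr_add[symmetric]) simp
  qed (use p in simp)
  have W1: "W powr (p - 2) * W = W powr (p - 1)"
    using W powr_add[of W "p - 2" 1] by (cases "W = 0") auto
  have Z: "(W * \<bar>t\<bar> / \<delta>) powr p = Z"
    unfolding Z_def using W \<delta> by (simp add: powr_divide powr_mult)
  have "Y powr (p / (p - 1)) = \<bar>\<beta>\<bar> powr (p / (p - 1)) * (W * \<bar>t\<bar> / \<delta>) powr p"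
    unfolding Y_def using W \<delta> p by (simp add: powr_mult powr_powr)
  then have Yq: "Y powr (p / (p - 1)) = \<bar>\<beta>\<bar> powr (p / (p - 1)) * Z" by (simp only: Z)
  have "N * Y \<le> N powr p / p + Y powr (p / (p - 1)) / (p / (p - 1))"
    using p N by (intro Youngs_inequality) (auto simp: Y_def field_simps)
  then have "p * (N * Y) \<le> p * (N powr p / p + Y powr (p / (p - 1)) / (p / (p - 1)))"
    using p by (intro mult_left_mono) auto
  \<comment> \<open>Dividing p by the conjugate exponent leaves p - 1, the factor in front of the
    final constant.\<close>
  also have "\<dots> = N powr p + (p - 1) * Y powr (p / (p - 1))" using p by (simp add: field_simps)
  finally have young: "p * (N * Y) \<le> N powr p + (p - 1) * (\<bar>\<beta>\<bar> powr (p / (p - 1)) * Z)" by (simp only: Yq)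
  have "- \<beta> * (W powr (p - 2) * (p * b * \<delta> powr (1 - p) * S)) \<le> \<bar>\<beta> * (W powr (p - 2) * (p * b * \<delta> powr (1 - p) * S))\<bar>"
    by simp
  also have "\<dots> = p * (\<bar>\<beta>\<bar> * W powr (p - 2) * \<bar>t\<bar> powr (p - 1) * \<delta> powr (1 - p)) * \<bar>S\<bar>"
    using p by (simp add: abs_mult b mult_ac)
  also have "\<dots> \<le> p * (\<bar>\<beta>\<bar> * W powr (p - 2) * \<bar>t\<bar> powr (p - 1) * \<delta> powr (1 - p)) * (W * N)"
    using p S by (intro mult_left_mono) auto
  also have "\<dots> = p * (\<bar>\<beta>\<bar> * (W powr (p - 2) * W) * \<bar>t\<bar> powr (p - 1) * \<delta> powr (1 - p)) * N"
    by (simp add: mult_ac)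
  also have "\<dots> = p * (N * Y)"
  proof -
    have "\<delta> powr (1 - p) = 1 / \<delta> powr (p - 1)" using powr_minus_divide[of \<delta> "p - 1"] by simp
    then show ?thesis unfolding W1 Y_def using W \<delta> by (simp add: powr_divide powr_mult)
  qed
  finally have 1: "- \<beta> * (W powr (p - 2) * (p * b * \<delta> powr (1 - p) * S)) \<le> p * (N * Y)" .
  have "W powr (p - 2) * ((1 - p) * \<bar>t\<bar> powr p * \<delta> powr (- p) * W\<^sup>2)
      = (1 - p) * \<bar>t\<bar> powr p * \<delta> powr (- p) * (W powr (p - 2) * W\<^sup>2)" by (simp add: mult_ac)
  also have "\<dots> = (1 - p) * Z" unfolding W2 Z_def by (simp add: powr_minus_divide)
  finally have 2: "W powr (p - 2) * ((1 - p) * \<bar>t\<bar> powr p * \<delta> powr (- p) * W\<^sup>2) = (1 - p) * Z" .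
  show ?thesis
    unfolding WW distrib_left[of "W powr (p - 2)"] 2 Z_def[symmetric] using 1 young
    by (simp add: algebra_simps)
qed

text \<open>Lets an integrand with unspecified values on a null set be replaced by a well-behaved
  one. Completeness of Lebesgue measure makes \<open>g\<close> integrable whatever its values on
  \<open>N\<close> are.\<close>

lemma set_lebesgue_integral_eq_lborel_integral:
  fixes f g :: "'a::euclidean_space \<Rightarrow> real"
  assumes f: "integrable lborel f" and supp: "\<And>x. x \<notin> H \<Longrightarrow> f x = 0"
    and N: "negligible N" and eq: "\<And>x. x \<in> H - N \<Longrightarrow> g x = f x"
  shows "(LINT x:H|lebesgue. g x) = (\<integral>x. f x \<partial>lborel)"
proof -
  have ind: "(\<lambda>x. indicator H x *\<^sub>R f x) = f" using supp by (auto simp: indicator_def fun_eq_iff)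
  have f_on: "f absolutely_integrable_on H"
    unfolding set_integrable_def ind using f by (rule integrable_completion[THEN iffD2, rotated]) (use f in auto)
  then have g_on: "g absolutely_integrable_on H"
    using absolutely_integrable_spike[OF _ N] eq by blast
  have "(LINT x:H|lebesgue. g x) = integral H g" by (rule set_lebesgue_integral_eq_integral(2)[OF g_on])
  also have "\<dots> = integral H f" using N eq by (intro integral_spike[of N]) auto
  also have "\<dots> = (LINT x:H|lebesgue. f x)" by (rule set_lebesgue_integral_eq_integral(2)[OF f_on, symmetric])
  also have "\<dots> = (\<integral>x. f x \<partial>lebesgue)" unfolding set_lebesgue_integral_def ind ..
  also have "\<dots> = (\<integral>x. f x \<partial>lborel)" using f by (intro integral_completion) auto
  finally show ?thesis .
qed

lemma integrable_continuous_compact_support: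
  fixes f :: "'a::euclidean_space \<Rightarrow> real"
  assumes "compact K" "continuous_on K f" "\<And>x. x \<notin> K \<Longrightarrow> f x = 0"
  shows "integrable lborel f"
proof -
  have "(\<lambda>x. indicator K x *\<^sub>R f x) = f" using assms(3) by (auto simp: indicator_def fun_eq_iff)
  then show ?thesis using borel_integrable_compact[OF assms(1,2)] by simp
qed

section \<open>The distance function in coordinates and the conclusion\<close>

lemma horizontal_grad_boundary_dist:
  "horizontal_grad \<sigma> X (boundary_dist \<nu> d) y = (\<chi> k. if k \<in> first_layer \<sigma> then X k y \<bullet> \<nu> else 0)"
proof -
  have "(boundary_dist \<nu> d has_derivative (\<lambda>v. v \<bullet> \<nu>)) (at y)"
    unfolding boundary_dist_def[abs_def] by (auto intro!: derivative_eq_intros)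
  then show ?thesis
    unfolding horizontal_grad_def deriv_along_def using frechet_derivative_at by metis
qed

lemma norm_horizontal_vector:
  fixes f :: "'n::finite \<Rightarrow> real"
  shows "norm (\<chi> k. if k \<in> L then f k else 0) = L2_set f L"
proof -
  have "(\<Sum>k\<in>UNIV. (norm (if k \<in> L then f k else 0))\<^sup>2) = (\<Sum>k\<in>L. (f k)\<^sup>2)"
    by (rule sum.mono_neutral_cong_right) auto
  then show ?thesis by (simp add: norm_vec_def L2_set_def)
qed

theorem theorem2p1:
  fixes \<sigma> :: "'n::finite \<Rightarrow> nat"
    and mul :: "real^'n \<Rightarrow> real^'n \<Rightarrow> real^'n"
    and X :: "'n \<Rightarrow> real^'n \<Rightarrow> real^'n"
    and \<nu> :: "real^'n" and d \<beta> p :: real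
    and u :: "real^'n \<Rightarrow> real"
  assumes "stratified_group r \<sigma> mul X"
    and "norm \<nu> = 1"
    and "p > 1"
    and "u \<in> test_functions (half_space \<nu> d)"
  shows "(LINT x:half_space \<nu> d|lebesgue. norm (horizontal_grad \<sigma> X u x) powr p)
    \<ge> - (p - 1) * (\<bar>\<beta>\<bar> powr (p / (p - 1)) + \<beta>) *
        (LINT x:half_space \<nu> d|lebesgue.
           angle_function \<sigma> X \<nu> x powr p / boundary_dist \<nu> d x powr p * \<bar>u x\<bar> powr p)
      + \<beta> *
        (LINT x:half_space \<nu> d|lebesgue.
           p_sub_laplacian \<sigma> X p (boundary_dist \<nu> d) x / boundary_dist \<nu> d x powr (p - 1) * \<bar>u x\<bar> powr p)"
proof -
  note G = assms(1) and p = assms(3)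
  define L where "L = first_layer \<sigma>"
  define H where "H = half_space \<nu> d"
  define \<delta> where "\<delta> = boundary_dist \<nu> d"
  define w where "w k x = X k x \<bullet> \<nu>" for k x
  have grad_\<delta>: "horizontal_grad \<sigma> X \<delta> y = (\<chi> k. if k \<in> L then w k y else 0)" for y
    unfolding \<delta>_def L_def w_def by (rule horizontal_grad_boundary_dist)
  have angle: "angle_function \<sigma> X \<nu> x = sqrt (\<Sum>k\<in>L. (w k x)\<^sup>2)" for x
    by (simp add: angle_function_def L_def w_def)
  show ?thesis
  \<comment> \<open>If all w_k vanish identically, both integrands on the right are 0 and the left
    side is nonnegative. Otherwise one component is nonzero somewhere, as the flux theorem
    requires.\<close>
  proof (cases "\<forall>k\<in>L. \<forall>x. w k x = 0")
    case True
    have "horizontal_grad \<sigma> X \<delta> y = 0" for y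
      using True by (auto simp: grad_\<delta> vec_eq_iff)
    then have "p_sub_laplacian \<sigma> X p \<delta> x = 0" for x
      by (simp add: p_sub_laplacian_def horizontal_div_def deriv_along_def)
    moreover have "angle_function \<sigma> X \<nu> x = 0" for x
      using True by (simp add: angle)
    ultimately show ?thesis
      unfolding \<delta>_def[symmetric]
      by (simp add: set_lebesgue_integral_def Bochner_Integration.integral_nonneg)
  next
    case False
    then obtain k0 a where k0: "k0 \<in> L" "w k0 a \<noteq> 0" by blast
    define K where "K = closure {x. u x \<noteq> 0}"
    have u: "smooth_on UNIV u" and Kcomp: "compact K" and KH: "K \<subseteq> H"
      using assms(4) by (auto simp: test_functions_def K_def H_def)
    have Kc: "closed K" by (simp add: K_def)
    have offK: "x \<notin> K" if "x \<notin> H" for x using that KH by blast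
    have supp: "u x = 0" if "x \<notin> K" for x
      using that closure_subset[of "{x. u x \<noteq> 0}"] by (auto simp: K_def)
    define u' where "u' x = frechet_derivative u (at x)" for x
    have u': "(u has_derivative u' x) (at x)" for x
      unfolding u'_def by (rule smooth_on_has_derivative[OF u])
    have u'_cont: "continuous_on UNIV (\<lambda>x. u' x v)" for v
      unfolding u'_def by (rule smooth_on_continuous[OF smooth_on_directional_deriv[OF u]])
    have u_cont: "continuous_on UNIV u" by (rule smooth_on_continuous[OF u])
    have u'_supp: "u' x v = 0" if "x \<notin> K" for x v
      using has_derivative_zero_off_support[OF u' Kc that supp] .
    define \<phi> where "\<phi> x = \<bar>u x\<bar> powr p * \<delta> x powr (1 - p)" for x
    define \<phi>' where "\<phi>' x v = p * signed_powr (p - 1) (u x) * u' x v * \<delta> x powr (1 - p)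
      + \<bar>u x\<bar> powr p * ((1 - p) * \<delta> x powr (- p) * (v \<bullet> \<nu>))" for x v
    have \<phi>: "(\<phi> has_derivative \<phi>' x) (at x)" "continuous_on UNIV (\<lambda>x. \<phi>' x v)"
      "x \<notin> K \<Longrightarrow> \<phi>' x v = 0" for x v
      unfolding \<phi>_def[abs_def] \<phi>'_def[abs_def] \<delta>_def
      by (rule powr_quotient_derivative[OF p u' u'_cont Kc KH[unfolded H_def] supp] | assumption)+
    define X' where "X' k j x = frechet_derivative (\<lambda>x. X k x $ j) (at x)" for k j x
    define w' where "w' k x v = (\<Sum>j\<in>UNIV. \<nu> $ j * X' k j x v)" for k x v
    have X_smooth: "smooth_on UNIV (\<lambda>x. X k x $ j)" if "k \<in> L" for k j
      using stratified_group_generators(1)[OF G] that by (simp add: L_def)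
    have X': "((\<lambda>x. X k x $ j) has_derivative X' k j x) (at x)" if "k \<in> L" for k j x
      unfolding X'_def by (rule smooth_on_has_derivative[OF X_smooth[OF that]])
    have X'_cont: "continuous_on UNIV (\<lambda>x. X' k j x v)" if "k \<in> L" for k j v
      unfolding X'_def by (rule smooth_on_continuous[OF smooth_on_directional_deriv[OF X_smooth[OF that]]])
    have w_eq: "w k = (\<lambda>x. \<Sum>j\<in>UNIV. \<nu> $ j * X k x $ j)" for k
      by (simp add: fun_eq_iff w_def inner_vec_def mult.commute)
    \<comment> \<open>The number of layers \<open>r\<close> serves as the degree bound, and w_k
      inherits it as a fixed linear combination of the coefficients of X_k.\<close>
    interpret horizontal_flux L p r X X' w w' \<phi> \<phi>' K
    proof
      show "(w k has_derivative w' k x) (at x)" if "k \<in> L" for k x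
        unfolding w_eq w'_def[abs_def] by (intro has_derivative_sum has_derivative_mult_right X' that)
      show "continuous_on UNIV (\<lambda>x. w' k x v)" if "k \<in> L" for k v
        unfolding w'_def by (intro continuous_intros X'_cont that)
      show "poly_on_lines r (w k)" if "k \<in> L" for k
        unfolding w_eq using stratified_group_generator_poly_on_lines[OF G] that
        by (intro poly_on_lines_sum) (simp add: L_def)
      show "X' k j x (axis j 1) = 0" if "k \<in> L" for k j x
        using stratified_group_generator_partial_deriv_eq_0[OF G] that by (simp add: X'_def L_def)
    qed (use p X' X'_cont \<phi> Kcomp supp in \<open>auto simp: \<phi>_def\<close>)
    define N where "N x = norm (horizontal_grad \<sigma> X u x)" for x
    have N_eq: "N x = L2_set (\<lambda>k. u' x (X k x)) L" for x
      unfolding N_def horizontal_grad_def deriv_along_def u'_def L_def[symmetric]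
      by (rule norm_horizontal_vector)
    have pos: "\<delta> x > 0" if "x \<in> H" for x
      using that by (simp add: \<delta>_def H_def half_space_def boundary_dist_def)
    have angle_Q: "angle_function \<sigma> X \<nu> x = sqrt (Q x)" for x by (simp add: angle Q_def)

    have u'_X_cont: "continuous_on UNIV (\<lambda>x. u' x (X k x))" if "k \<in> L" for k
      by (subst deriv_eq_sum_partial_derivs[OF has_derivative_linear[OF u']])
        (intro continuous_intros X_cont u'_cont that)
    have "continuous_on UNIV (\<lambda>x. N x powr p)"
      unfolding N_eq L2_set_def using p
      by (intro continuous_on_powr' continuous_intros u'_X_cont) (auto intro: sum_nonneg)
    then have intA: "integrable lborel (\<lambda>x. N x powr p)"
      by (intro integrable_continuous_compact_support[OF Kcomp])
        (auto intro: continuous_on_subset simp: N_eq u'_supp L2_set_def)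
    define B where "B x = sqrt (Q x) powr p / \<delta> x powr p * \<bar>u x\<bar> powr p" for x
    have "continuous_on K B"
      unfolding B_def \<delta>_def boundary_dist_def using p KH
      by (intro continuous_intros continuous_on_powr'[of _ "\<lambda>x. sqrt (Q x)"] continuous_on_powr'[of _ "\<lambda>x. \<bar>u x\<bar>"]
          continuous_on_subset[OF Q_cont] continuous_on_subset[OF u_cont])
        (auto simp: Q_nonneg H_def half_space_def)
    then have intB: "integrable lborel B"
      by (intro integrable_continuous_compact_support[OF Kcomp]) (auto simp: B_def supp)
    define T where "T x = (\<Sum>k\<in>L. V 0 k x * \<phi>' x (X k x))" for x
    note flux = integral_flux[OF k0, folded T_def]

    have negl: "negligible {x. w k0 x = 0}"
      by (rule negligible_zeros_poly_on_lines[OF w_poly[OF k0(1)] w_cont[OF k0(1)] k0(2)])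
    \<comment> \<open>One nonzero component already gives \<open>Q x > 0\<close>, so the
      unregularized field is differentiable at x and the formal divergence is the actual
      one.\<close>
    have lap: "p_sub_laplacian \<sigma> X p \<delta> x = G 0 x" if "w k0 x \<noteq> 0" for x
    proof -
      have Qpos: "Q x + 0 > 0"
        using sq_le_Q[OF k0(1), of x] that by (simp add: less_le_trans[OF _ sq_le_Q[OF k0(1)]])
      have "(norm (horizontal_grad \<sigma> X \<delta> y) powr (p - 2) *\<^sub>R horizontal_grad \<sigma> X \<delta> y) $ k = V 0 k y" if "k \<in> L" for k y
      proof -
        have "norm (horizontal_grad \<sigma> X \<delta> y) = sqrt (Q y)"
          unfolding grad_\<delta> norm_horizontal_vector by (simp add: L2_set_def Q_def)
        also have "\<dots> = Q y powr (1 / 2)" using Q_nonneg[of y] by (simp add: powr_half_sqrt)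
        finally have "norm (horizontal_grad \<sigma> X \<delta> y) powr (p - 2) = Q y powr ((p - 2) / 2)"
          by (simp add: powr_powr)
        then show ?thesis using that by (simp add: V_def grad_\<delta>)
      qed
      then have "p_sub_laplacian \<sigma> X p \<delta> x = (\<Sum>k\<in>L. deriv_along (X k) (V 0 k) x)"
        unfolding p_sub_laplacian_def horizontal_div_def L_def[symmetric]
        by (intro sum.cong refl) simp
      also have "\<dots> = G 0 x"
        unfolding G_def deriv_along_def
        by (intro sum.cong refl) (use frechet_derivative_at[OF has_derivative_V[OF _ Qpos]] in metis)
      finally show ?thesis .
    qed
    have A: "(LINT x:H|lebesgue. norm (horizontal_grad \<sigma> X u x) powr p) = (\<integral>x. N x powr p \<partial>lborel)"
      by (rule set_lebesgue_integral_eq_lborel_integral[OF intA, of _ "{}"])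
        (use offK u'_supp in \<open>auto simp: N_eq L2_set_def N_def[symmetric]\<close>)
    have B: "(LINT x:H|lebesgue. angle_function \<sigma> X \<nu> x powr p / \<delta> x powr p * \<bar>u x\<bar> powr p) = (\<integral>x. B x \<partial>lborel)"
      by (rule set_lebesgue_integral_eq_lborel_integral[OF intB, of _ "{}"])
        (use offK supp in \<open>auto simp: B_def angle_Q\<close>)
    \<comment> \<open>Of the three integrals only this one needs an exceptional set: the null set
      where w_k0 vanishes and the p-sub-Laplacian may be unspecified.\<close>
    have C: "(LINT x:H|lebesgue. p_sub_laplacian \<sigma> X p \<delta> x / \<delta> x powr (p - 1) * \<bar>u x\<bar> powr p) = (\<integral>x. G 0 x * \<phi> x \<partial>lborel)"
    proof (rule set_lebesgue_integral_eq_lborel_integral[OF flux(1) _ negl])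
      show "G 0 x * \<phi> x = 0" if "x \<notin> H" for x
        using offK[OF that] supp[of x] by (auto simp: \<phi>_def)
      fix x assume "x \<in> H - {x. w k0 x = 0}"
      then show "p_sub_laplacian \<sigma> X p \<delta> x / \<delta> x powr (p - 1) * \<bar>u x\<bar> powr p = G 0 x * \<phi> x"
        using powr_minus_divide[of "\<delta> x" "p - 1"] by (simp add: lap \<phi>_def)
    qed

    have pointwise: "- (p - 1) * (\<bar>\<beta>\<bar> powr (p / (p - 1)) + \<beta>) * B x - \<beta> * T x \<le> N x powr p" for x
    proof (cases "x \<in> K")
      case False
      then show ?thesis by (simp add: B_def T_def supp \<phi>(3))
    next
      case True
      \<comment> \<open>The inner product of w and the horizontal gradient of \<open>u\<close>,
        bounded by Cauchy-Schwarz; it is what remains of \<open>\<phi>'\<close> along the generators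
        besides the derivative of the distance.\<close>
      define S where "S = (\<Sum>k\<in>L. w k x * u' x (X k x))"
      have "\<bar>S\<bar> \<le> (\<Sum>k\<in>L. \<bar>w k x\<bar> * \<bar>u' x (X k x)\<bar>)"
        unfolding S_def abs_mult[symmetric] by (rule sum_abs)
      also have "\<dots> \<le> L2_set (\<lambda>k. w k x) L * L2_set (\<lambda>k. u' x (X k x)) L" by (rule L2_set_mult_ineq)
      also have "\<dots> = sqrt (Q x) * N x" by (simp add: N_eq Q_def L2_set_def)
      finally have S: "\<bar>S\<bar> \<le> sqrt (Q x) * N x" .
      have "T x = Q x powr ((p - 2) / 2) * (\<Sum>k\<in>L. w k x * \<phi>' x (X k x))"
        unfolding T_def V_def sum_distrib_left by (simp add: mult.assoc)
      also have "(\<Sum>k\<in>L. w k x * \<phi>' x (X k x)) = p * signed_powr (p - 1) (u x) * \<delta> x powr (1 - p) * S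
          + (1 - p) * \<bar>u x\<bar> powr p * \<delta> x powr (- p) * Q x"
        unfolding \<phi>'_def w_def[symmetric] distrib_left sum.distrib S_def Q_def sum_distrib_left
        by (intro arg_cong2[of _ _ _ _ "(+)"] sum.cong) (auto simp: power2_eq_square mult_ac)
      finally have T: "T x = ((sqrt (Q x))\<^sup>2) powr ((p - 2) / 2) * (p * signed_powr (p - 1) (u x) * \<delta> x powr (1 - p) * S
          + (1 - p) * \<bar>u x\<bar> powr p * \<delta> x powr (- p) * (sqrt (Q x))\<^sup>2)"
        using Q_nonneg[of x] by simp
      show ?thesis
        unfolding T B_def using True KH
        by (intro hardy_pointwise[OF p _ _ pos S abs_signed_powr]) (auto simp: N_def Q_nonneg)
    qed
    \<comment> \<open>The flux identity turns the term with the p-sub-Laplacian into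
      \<open>- \<beta> * T x\<close>, after which the pointwise inequality is integrated.\<close>
    have "- (p - 1) * (\<bar>\<beta>\<bar> powr (p / (p - 1)) + \<beta>) * (\<integral>x. B x \<partial>lborel) + \<beta> * (\<integral>x. G 0 x * \<phi> x \<partial>lborel)
        = (\<integral>x. - (p - 1) * (\<bar>\<beta>\<bar> powr (p / (p - 1)) + \<beta>) * B x - \<beta> * T x \<partial>lborel)"
      using intB flux(2,3) by simp
    also have "\<dots> \<le> (\<integral>x. N x powr p \<partial>lborel)"
      using intA intB flux(2) pointwise by (intro integral_mono) auto
    finally show ?thesis
      unfolding A[symmetric] B[symmetric] C[symmetric] H_def \<delta>_def .
  qed
qed

end
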